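(* For $n\ge1$ and $k\ge 0$, let $\tilde\Gamma_{n,k}$ be the set of permutations $\sigma\in\mathfrak S_n$ with no double descents and with $\mathrm{des}(\sigma)=k$, and let $$\tilde\gamma_{n,k}(q):=\sum_{\sigma\in\tilde\Gamma_{n,k}}q^{\mathrm{inv}(\sigma)}\quad\Bigl(=\sum_{\sigma\in\tilde\Gamma_{n,k}}q^{\mathrm{maj}(\sigma^{-1})}\Bigr).$$ Then for all $n\ge 1$, $$\tilde A_n(q,t)=\sum_{k=0}^{\lfloor n/2\rfloor}\tilde\gamma_{n,k}(q)\,t^k(1+t)^{n-2k}.$$ Consequently, the $q$-binomial-Eulerian polynomials $\tilde A_n(q,t)$ are $q$-$\gamma$-positive.
   Context: For $\sigma\in\mathfrak S_n$: $\mathrm{DES}(\sigma)=\{i\in[n-1]:\sigma(i)>\sigma(i+1)\}$, $\mathrm{des}(\sigma)=|\mathrm{DES}(\sigma)|$, $\mathrm{maj}(\sigma)=\sum_{i\in\mathrm{DES}(\sigma)}i$, $\mathrm{exc}(\sigma)=|\{i\in[n-1]:\sigma(i)>i\}|$, $\mathrm{inv}(\sigma)=|\{(i,j):1\le i<j\le n,\ \sigma(i)>\sigma(j)\}|$. A double descent of $\sigma$ is an $i\in[n-2]$ with $\sigma(i)>\sigma(i+1)>\sigma(i+2)$. The $q$-Eulerian polynomials are $A_n(q,t):=\sum_{\sigma\in\mathfrak S_n}q^{\mathrm{maj}(\sigma)-\mathrm{exc}(\sigma)}t^{\mathrm{exc}(\sigma)}$ for $n\ge1$, and $A_0(q,t):=1$.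 The $q$-binomial-Eulerian polynomials are $$\tilde A_n(q,t):=1+t\sum_{m=1}^n\binom{n}{m}_qA_m(q,t),$$ where $\binom nm_q=\frac{[n]_q!}{[m]_q![n-m]_q!}$, $[n]_q!=\prod_{j=1}^n[j]_q$, $[j]_q=\sum_{i=0}^{j-1}q^i$. A polynomial in $\mathbb R[q]$ is $q$-positive if its coefficients are nonnegative. A polynomial $A(t)\in\mathbb R[q][t]$ is $q$-$\gamma$-positive if for some $d$ there exist $q$-positive $\gamma_0,\dots,\gamma_{\lfloor d/2\rfloor}\in\mathbb R[q]$ with $A(t)=\sum_{k=0}^{\lfloor d/2\rfloor}\gamma_kt^k(1+t)^{d-2k}$. *)

theory Defs
  imports
    "HOL-Combinatorics.Permutations"
    "HOL-Computational_Algebra.Polynomial"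
    "HOL-Computational_Algebra.Field_as_Ring"
begin

text \<open>A permutation in \<open>S_n\<close> is a function \<open>\<sigma> :: nat \<Rightarrow> nat\<close> with \<open>\<sigma> permutes {1..n}\<close>.
  The ring \<open>\<real>[q][t]\<close> is \<open>real poly poly\<close>: the inner variable is \<open>q\<close>, the outer one is \<open>t\<close>,
  and \<open>smult\<close> multiplies by a scalar from \<open>\<real>[q]\<close>.\<close>

abbreviation qv :: "real poly" where
  "qv \<equiv> [:0, 1:]"

abbreviation tv :: "real poly poly" where
  "tv \<equiv> [:0, 1:]"

definition DES :: "nat \<Rightarrow> (nat \<Rightarrow> nat) \<Rightarrow> nat set" where
  "DES n \<sigma> = {i \<in> {1..n - 1}. \<sigma> i > \<sigma> (i + 1)}"

definition des :: "nat \<Rightarrow> (nat \<Rightarrow> nat) \<Rightarrow> nat" where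
  "des n \<sigma> = card (DES n \<sigma>)"

definition maj :: "nat \<Rightarrow> (nat \<Rightarrow> nat) \<Rightarrow> nat" where
  "maj n \<sigma> = (\<Sum>i\<in>DES n \<sigma>. i)"

definition exc :: "nat \<Rightarrow> (nat \<Rightarrow> nat) \<Rightarrow> nat" where
  "exc n \<sigma> = card {i \<in> {1..n - 1}. \<sigma> i > i}"

definition inv_count :: "nat \<Rightarrow> (nat \<Rightarrow> nat) \<Rightarrow> nat" where
  "inv_count n \<sigma> = card {(i, j). 1 \<le> i \<and> i < j \<and> j \<le> n \<and> \<sigma> i > \<sigma> j}"

definition double_descent :: "nat \<Rightarrow> (nat \<Rightarrow> nat) \<Rightarrow> nat \<Rightarrow> bool" where
  "double_descent n \<sigma> i \<longleftrightarrow> i \<in> {1..n - 2} \<and> \<sigma> i > \<sigma> (i + 1) \<and> \<sigma> (i + 1) > \<sigma> (i + 2)"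

text \<open>The natural-number difference \<open>maj - exc\<close> occurring below never truncates: after its last
  descent \<open>d\<close> a permutation increases, so all its excedances are at most \<open>d\<close>.\<close>

lemma exc_le_maj:
  assumes p: "\<sigma> permutes {1..n}"
  shows "exc n \<sigma> \<le> maj n \<sigma>"
proof -
  have fin: "finite (DES n \<sigma>)" by (simp add: DES_def)
  have "{i \<in> {1..n - 1}. \<sigma> i > i} \<subseteq> {1..maj n \<sigma>}"
  proof
    fix i assume i: "i \<in> {i \<in> {1..n - 1}. \<sigma> i > i}"
    show "i \<in> {1..maj n \<sigma>}"
    proof (rule ccontr)
      assume "i \<notin> {1..maj n \<sigma>}"
      with i have gt: "i > maj n \<sigma>" by auto
      have step: "\<sigma> k \<le> \<sigma> (k + 1)" if "i \<le> k" "k < n" for k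
      proof (rule ccontr)
        assume "\<not> \<sigma> k \<le> \<sigma> (k + 1)"
        then have "k \<in> DES n \<sigma>" using that i by (auto simp: DES_def)
        then have "k \<le> maj n \<sigma>" unfolding maj_def
          using member_le_sum[of k "DES n \<sigma>" "\<lambda>i. i"] fin by simp
        then show False using gt that by simp
      qed
      have inj: "\<sigma> a = \<sigma> b \<Longrightarrow> a = b" for a b
        using permutes_inj[OF p] by (auto dest: injD)
      have grow: "k \<le> n \<longrightarrow> \<sigma> k \<ge> k + 1" if "i \<le> k" for k
        using that
      proof (induction k rule: dec_induct)
        case base
        then show ?case using i by simp
      next
        case (step k)
        then show ?case
          using \<open>\<And>k. i \<le> k \<Longrightarrow> k < n \<Longrightarrow> \<sigma> k \<le> \<sigma> (k + 1)\<close>[of k] inj[of k "k + 1"]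
          by fastforce
      qed
      have "\<sigma> n \<ge> n + 1" using grow[of n] i by auto
      moreover have "\<sigma> n \<in> {1..n}" using permutes_in_image[OF p, of n] i by auto
      ultimately show False by simp
    qed
  qed
  then have "card {i \<in> {1..n - 1}. \<sigma> i > i} \<le> card {1..maj n \<sigma>}"
    by (intro card_mono) auto
  then show ?thesis by (simp add: exc_def)
qed

definition q_int :: "nat \<Rightarrow> real poly" where
  "q_int j = (\<Sum>i<j. qv ^ i)"

definition q_fact :: "nat \<Rightarrow> real poly" where
  "q_fact n = (\<Prod>j=1..n. q_int j)"

definition q_binomial :: "nat \<Rightarrow> nat \<Rightarrow> real poly" where
  "q_binomial n m = q_fact n div (q_fact m * q_fact (n - m))"

text \<open>The polynomial division in \<^const>\<open>q_binomial\<close> is exact.\<close>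

lemma q_int_add: "q_int (a + b) = q_int a + qv ^ a * q_int b"
  by (induction b) (simp_all add: q_int_def power_add distrib_left del: power_Suc mult_pCons_left)

lemma q_fact_Suc: "q_fact (Suc n) = q_int (Suc n) * q_fact n"
  by (simp add: q_fact_def mult.commute)

lemma q_fact_dvd_add: "q_fact a * q_fact b dvd q_fact (a + b)"
proof (induction "a + b" arbitrary: a b)
  case 0
  then show ?case by (simp add: q_fact_def)
next
  case (Suc s)
  show ?case
  proof (cases "a = 0 \<or> b = 0")
    case True
    then show ?thesis by (auto simp: q_fact_def)
  next
    case False
    then obtain a' b' where ab: "a = Suc a'" "b = Suc b'"
      by (metis not0_implies_Suc)
    have 1: "q_int a * (q_fact a' * q_fact b) dvd q_int a * q_fact (a' + b)"
      using Suc(1)[of a' b] Suc(2) ab by (intro mult_dvd_mono) auto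
    have 2: "q_int b * (q_fact a * q_fact b') dvd q_int b * q_fact (a + b')"
      using Suc(1)[of a b'] Suc(2) ab by (intro mult_dvd_mono) auto
    have e: "q_fact (a + b) = q_int a * q_fact (a' + b) + qv ^ a * (q_int b * q_fact (a + b'))"
    proof -
      have "q_fact (a + b) = q_int (a + b) * q_fact (a' + b)"
        using ab q_fact_Suc[of "a' + b"] by simp
      moreover have "a + b' = a' + b" using ab by simp
      ultimately show ?thesis by (simp only: q_int_add distrib_right mult.assoc)
    qed
    have 1: "q_fact a * q_fact b dvd q_int a * q_fact (a' + b)"
      using 1 unfolding ab q_fact_Suc by (simp only: ac_simps)
    have 2: "q_fact a * q_fact b dvd q_int b * q_fact (a + b')"
      using 2 unfolding ab q_fact_Suc by (simp only: ac_simps)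
    show ?thesis unfolding e by (intro dvd_add 1 dvd_mult 2)
  qed
qed

lemma q_binomial_exact:
  assumes "m \<le> n"
  shows "q_binomial n m * (q_fact m * q_fact (n - m)) = q_fact n"
  unfolding q_binomial_def using q_fact_dvd_add[of m "n - m"] assms by simp

definition q_Eulerian :: "nat \<Rightarrow> real poly poly" where
  "q_Eulerian n =
     (if n = 0 then 1
      else (\<Sum>\<sigma> | \<sigma> permutes {1..n}. smult (qv ^ (maj n \<sigma> - exc n \<sigma>)) (tv ^ exc n \<sigma>)))"

definition q_binomial_Eulerian :: "nat \<Rightarrow> real poly poly" where
  "q_binomial_Eulerian n = 1 + tv * (\<Sum>m=1..n. smult (q_binomial n m) (q_Eulerian m))"

definition q_positive :: "real poly \<Rightarrow> bool" where
  "q_positive p \<longleftrightarrow> (\<forall>i. coeff p i \<ge> 0)"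

definition q_gamma_positive :: "real poly poly \<Rightarrow> bool" where
  "q_gamma_positive A \<longleftrightarrow>
     (\<exists>(d::nat) (\<gamma> :: nat \<Rightarrow> real poly). (\<forall>k\<le>d div 2. q_positive (\<gamma> k)) \<and>
        A = (\<Sum>k=0..d div 2. smult (\<gamma> k) (tv ^ k * (1 + tv) ^ (d - 2 * k))))"

definition Gamma_tilde :: "nat \<Rightarrow> nat \<Rightarrow> (nat \<Rightarrow> nat) set" where
  "Gamma_tilde n k = {\<sigma>. \<sigma> permutes {1..n} \<and> (\<nexists>i. double_descent n \<sigma> i) \<and> des n \<sigma> = k}"

definition gamma_tilde :: "nat \<Rightarrow> nat \<Rightarrow> real poly" where
  "gamma_tilde n k = (\<Sum>\<sigma>\<in>Gamma_tilde n k. qv ^ inv_count n \<sigma>)"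

end

theory Submission
  imports Defs "HOL-Combinatorics.Multiset_Permutations" "HOL-Analysis.Elementary_Metric_Spaces"
    "HOL-Analysis.Infinite_Sum"
begin

text \<open>Fix real \<open>0 < q < 1\<close> and \<open>0 < t < 1\<close>. Both sides, divided by \<open>(1 - q) \<dots> (1 - q^n)\<close>, are sums
  \<open>\<Sum> q^|b| f(b)\<close> over multisets \<open>b\<close> of \<open>n\<close> natural numbers, by the theory of \<open>P\<close>-partitions: a statistic
  \<open>\<Sum>i\<in>D. i\<close> is \<open>maj\<close> of the inverse for \<open>D = DES\<close> of the inverse, and \<open>maj - exc\<close> for the set \<open>D = DEX\<close> of
  Shareshian and Wachs. This reduces the theorem to an identity of numbers for each \<open>b\<close>.

  For \<open>maj - exc\<close>, standardization turns \<open>f(b)\<close> into the coefficient \<open>N(b)\<close> of \<open>x^b\<close> in a product of linear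
  forms, one for each entry of \<open>b\<close> in decreasing order; it equals \<open>\<Sum>S. (-t)^|S| M(b - S)\<close>, where \<open>M(b)\<close> is the
  coefficient of \<open>x^b\<close> in \<open>\<Prod>j\<in>b. L_j\<close>, as in MacMahon's master theorem, and \<open>S\<close> ranges over the subsets of the
  support of \<open>b\<close>. A cyclic shift of linear forms gives \<open>\<Sum>S. (-1)^|S| M(b - S) = t N(b)\<close> for \<open>b \<noteq> \<emptyset>\<close>, and hence
  \<open>M(b) = 1 + t \<Sum> N(c)\<close>, summed over \<open>\<emptyset> \<noteq> c \<subseteq> b\<close>, which is the binomial transform on the left-hand side. On the
  right-hand side, let \<open>R(b)\<close> be the sum of \<open>t^asc (1 + t)^(n - 2 asc)\<close> over the words with content \<open>b\<close> and without
  double ascents. Splitting a strictly increasing prefix off a word shows that the two alternating sums of \<open>R\<close>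
  satisfy the same relation as those of \<open>M\<close>, which determines the function, so \<open>R = M\<close>.

  Finally, \<open>inv\<close> and \<open>maj\<close> of the inverse have the same distribution on each descent class, since both satisfy the
  recursion obtained by splitting off the first run; for \<open>inv\<close> this is visible on Lehmer codes.\<close>

section \<open>P-partitions\<close>

text \<open>For nonnegative terms, summability over the product follows from summability of the row
  sums \<open>f x * b\<close>.\<close>

lemma has_sum_Times_nonneg:
  fixes f :: "'a \<Rightarrow> real" and g :: "'b \<Rightarrow> real"
  assumes "(f has_sum a) A" "(g has_sum b) B"
    and "\<And>x. x \<in> A \<Longrightarrow> f x \<ge> 0" "\<And>y. y \<in> B \<Longrightarrow> g y \<ge> 0"
  shows "((\<lambda>(x, y). f x * g y) has_sum (a * b)) (A \<times> B)"
proof -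
  have fb: "((\<lambda>x. f x * b) has_sum (a * b)) A"
    using assms(1) by (rule has_sum_cmult_left)
  have fg: "((\<lambda>y. (\<lambda>(x, y). f x * g y) (x, y)) has_sum (f x * b)) B" for x
    using has_sum_cmult_right[OF assms(2), of "f x"] by simp
  have "(\<lambda>(x, y). f x * g y) summable_on A \<times> B"
    using assms by (intro summable_on_SigmaI[where g = "\<lambda>x. f x * b"] fg has_sum_imp_summable[OF fb]) auto
  then show ?thesis
    by (rule has_sum_SigmaI[where g = "\<lambda>x. f x * b", rotated 2]) (rule fg fb)+
qed

text \<open>P-partitions of a chain, with forced drops at the positions in \<open>D\<close>.
  Positions count from 1 while list indices count from 0, and the appended 0 turns
  \<open>n \<in> D\<close> into positivity of the last entry.\<close>

definition descent_chains :: "nat \<Rightarrow> nat set \<Rightarrow> nat list set" where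
  "descent_chains n D = {c. length c = n \<and> (\<forall>i<n. (c @ [0]) ! Suc i + of_bool (Suc i \<in> D) \<le> c ! i)}"

text \<open>The q-Pochhammer symbol (q;q)_n.\<close>

definition qpoch :: "real \<Rightarrow> nat \<Rightarrow> real" where
  "qpoch q n = (\<Prod>i=1..n. 1 - q ^ i)"

lemma qpoch_0 [simp]: "qpoch q 0 = 1"
  by (simp add: qpoch_def)

lemma qpoch_Suc: "qpoch q (Suc n) = qpoch q n * (1 - q ^ Suc n)"
  by (simp add: qpoch_def)

lemma qpoch_pos:
  assumes "0 < q" "q < 1"
  shows "qpoch q n > 0"
  using assms by (auto simp: qpoch_def power_Suc_less_one[of q] Suc_le_eq power_less_one_iff intro!: prod_pos)

lemma geometric_has_sum_from:
  assumes "0 < (x::real)" "x < 1"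
  shows "((\<lambda>e. x ^ e) has_sum (x ^ k / (1 - x))) {k..}"
proof -
  have "((\<lambda>e. x ^ e) has_sum (1 / (1 - x))) UNIV"
    using assms by (intro norm_summable_imp_has_sum) (auto simp: power_abs geometric_sums intro!: summable_geometric)
  then have "((\<lambda>e. x ^ k * x ^ e) has_sum (x ^ k * (1 / (1 - x)))) UNIV"
    by (rule has_sum_cmult_right)
  then show ?thesis
    by (subst has_sum_reindex_bij_witness[of "{k..}" "\<lambda>e. e + k" "\<lambda>e. e - k" UNIV "\<lambda>e. x ^ k * x ^ e"
          "\<lambda>e. x ^ e" "x ^ k / (1 - x)", OF _ _ _ _ _ refl]) (auto simp: power_add[symmetric])
qed

lemma mem_descent_chains_iff:
  "c \<in> descent_chains n D \<longleftrightarrow> length c = n \<and>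
     (\<forall>i<n. (if Suc i < n then c ! Suc i else 0) + of_bool (Suc i \<in> D) \<le> c ! i)"
  by (auto simp: descent_chains_def nth_append less_Suc_eq not_less_eq)

lemma chains_ge_last:
  assumes "c \<in> descent_chains (Suc n) D" "i \<le> n"
  shows "c ! n \<le> c ! i"
  using assms(2)
proof (induction i rule: inc_induct)
  case (step i)
  have "(if Suc i < Suc n then c ! Suc i else 0) + of_bool (Suc i \<in> D) \<le> c ! i"
    using assms(1)[unfolded mem_descent_chains_iff, THEN conjunct2, rule_format, of i] step by linarith
  with step have "c ! Suc i \<le> c ! i" by simp
  with step show ?case by linarith
qed simp

text \<open>The last entry \<open>e\<close> is a lower bound for all the others, so it can be
  subtracted from them. What remains is a chain of length \<open>n\<close> with the same
  \<open>D\<close>, since only differences matter.\<close>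

lemma chains_Suc_bij:
  "bij_betw (\<lambda>(c, e). map (\<lambda>x. x + e) c @ [e]) (descent_chains n D \<times> {of_bool (Suc n \<in> D)..}) (descent_chains (Suc n) D)"
proof (rule bij_betwI[where g = "\<lambda>c. (map (\<lambda>x. x - last c) (butlast c), last c)"])
  show "(\<lambda>(c, e). map (\<lambda>x. x + e) c @ [e]) \<in> descent_chains n D \<times> {of_bool (Suc n \<in> D)..} \<rightarrow> descent_chains (Suc n) D"
  proof (intro funcsetI)
    fix x assume "x \<in> descent_chains n D \<times> {of_bool (Suc n \<in> D) :: nat..}"
    then obtain c e where x: "x = (c, e)" and c: "c \<in> descent_chains n D" and e: "(e::nat) \<ge> of_bool (Suc n \<in> D)"
      by auto
    let ?c = "map (\<lambda>x. x + e) c @ [e]"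
    have len: "length c = n" using c by (simp add: mem_descent_chains_iff)
    have "(if Suc i < Suc n then ?c ! Suc i else 0) + of_bool (Suc i \<in> D) \<le> ?c ! i" if "i < Suc n" for i
    proof (cases "i < n")
      case False
      with that have "i = n" by simp
      then show ?thesis using e len by (simp add: nth_append)
    next
      case True
      with c have "(if Suc i < n then c ! Suc i else 0) + of_bool (Suc i \<in> D) \<le> c ! i"
        unfolding mem_descent_chains_iff by blast
      with True len show ?thesis
        by (cases "Suc i = n") (auto simp: nth_append)
    qed
    then have "map (\<lambda>x. x + e) c @ [e] \<in> descent_chains (Suc n) D" using len unfolding mem_descent_chains_iff by simp
    then show "(\<lambda>(c, e). map (\<lambda>x. x + e) c @ [e]) x \<in> descent_chains (Suc n) D" by (simp add: x)
  qed
next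
  show "(\<lambda>c. (map (\<lambda>x. x - last c) (butlast c), last c)) \<in> descent_chains (Suc n) D \<rightarrow> descent_chains n D \<times> {of_bool (Suc n \<in> D)..}"
  proof (intro funcsetI)
    fix c assume c: "c \<in> descent_chains (Suc n) D"
    then have len: "length c = Suc n" by (simp add: mem_descent_chains_iff)
    then have last: "last c = c ! n" by (metis last_conv_nth diff_Suc_1 list.size(3) nat.distinct(1))
    have step: "(if Suc i < Suc n then c ! Suc i else 0) + of_bool (Suc i \<in> D) \<le> c ! i" if "i < Suc n" for i
      using c that by (simp only: mem_descent_chains_iff)
    have "of_bool (Suc n \<in> D) \<le> c ! n" using step[of n] by simp
    moreover have "map (\<lambda>x. x - last c) (butlast c) \<in> descent_chains n D"
      unfolding mem_descent_chains_iff
    proof (intro conjI allI impI)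
      fix i assume "i < n"
      with step[of i] chains_ge_last[OF c, of "Suc i"] len
      show "(if Suc i < n then map (\<lambda>x. x - last c) (butlast c) ! Suc i else 0) + of_bool (Suc i \<in> D)
          \<le> map (\<lambda>x. x - last c) (butlast c) ! i"
        by (cases "Suc i = n") (auto simp: nth_butlast last)
    qed (simp add: len)
    ultimately show "(map (\<lambda>x. x - last c) (butlast c), last c) \<in> descent_chains n D \<times> {of_bool (Suc n \<in> D)..}"
      by (simp add: last)
  qed
next
  fix c assume c: "c \<in> descent_chains (Suc n) D"
  then have len: "length c = Suc n" by (simp add: mem_descent_chains_iff)
  then have last: "last c = c ! n" by (metis last_conv_nth diff_Suc_1 list.size(3) nat.distinct(1))
  have "map (\<lambda>x. x + last c) (map (\<lambda>x. x - last c) (butlast c)) = butlast c"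
    using len chains_ge_last[OF c] by (intro nth_equalityI) (auto simp: nth_butlast last)
  moreover have "butlast c @ [last c] = c" using len by (intro append_butlast_last_id) auto
  ultimately show "(\<lambda>(c, e). map (\<lambda>x. x + e) c @ [e]) (map (\<lambda>x. x - last c) (butlast c), last c) = c"
    by simp
qed (auto simp: descent_chains_def o_def)

lemma sum_list_map_add: "sum_list (map (\<lambda>x. x + e) c) = sum_list c + length c * (e::nat)"
  by (induction c) auto

text \<open>In \<open>chains_Suc_bij\<close> the last entry \<open>e\<close> is added to all
  \<open>Suc n\<close> entries. It contributes a geometric series in \<open>q ^ Suc n\<close>, which
  starts at exponent 1 if \<open>Suc n \<in> D\<close> and at 0 otherwise.\<close>

lemma has_sum_chains:
  assumes "0 < q" "q < 1"
  shows "((\<lambda>c. q ^ sum_list c) has_sum (q ^ (\<Sum>(D \<inter> {1..n})) / qpoch q n)) (descent_chains n D)"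
proof (induction n)
  case 0
  have "descent_chains 0 D = {[]}" by (auto simp: descent_chains_def)
  then show ?case by (simp add: has_sum_finiteI)
next
  case (Suc n)
  let ?k = "of_bool (Suc n \<in> D) :: nat"
  have q: "0 < q ^ Suc n" "q ^ Suc n < 1" using assms power_Suc_less_one[of q n] by auto
  have "((\<lambda>(c, e). q ^ sum_list c * (q ^ Suc n) ^ e) has_sum
      (q ^ (\<Sum>(D \<inter> {1..n})) / qpoch q n * ((q ^ Suc n) ^ ?k / (1 - q ^ Suc n)))) (descent_chains n D \<times> {?k..})"
    using assms by (intro has_sum_Times_nonneg Suc.IH geometric_has_sum_from q) auto
  moreover have "q ^ sum_list c * (q ^ Suc n) ^ e = q ^ sum_list (map (\<lambda>x. x + e) c @ [e])"
    if "c \<in> descent_chains n D" for c e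
    using that by (simp add: sum_list_map_add mem_descent_chains_iff power_mult[symmetric] power_add[symmetric] algebra_simps
        del: power_Suc)
  ultimately have "((\<lambda>x. q ^ sum_list ((\<lambda>(c, e). map (\<lambda>x. x + e) c @ [e]) x)) has_sum
      (q ^ (\<Sum>(D \<inter> {1..n})) / qpoch q n * ((q ^ Suc n) ^ ?k / (1 - q ^ Suc n)))) (descent_chains n D \<times> {?k..})"
    by (subst has_sum_cong[where g = "\<lambda>(c, e). q ^ sum_list c * (q ^ Suc n) ^ e"]) auto
  then have "((\<lambda>c. q ^ sum_list c) has_sum
      (q ^ (\<Sum>(D \<inter> {1..n})) / qpoch q n * ((q ^ Suc n) ^ ?k / (1 - q ^ Suc n)))) (descent_chains (Suc n) D)"
    by (subst (asm) has_sum_reindex_bij_betw[OF chains_Suc_bij, where f = "\<lambda>c. q ^ sum_list c"])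
  moreover have "(\<Sum>(D \<inter> {1..Suc n})) = (\<Sum>(D \<inter> {1..n})) + Suc n * ?k"
  proof (cases "Suc n \<in> D")
    case True
    then have "D \<inter> {1..Suc n} = insert (Suc n) (D \<inter> {1..n})" by auto
    then show ?thesis using True by simp
  next
    case False
    then have "D \<inter> {1..Suc n} = D \<inter> {1..n}" by (auto simp: le_Suc_eq)
    then show ?thesis using False by simp
  qed
  ultimately show ?case by (simp only: qpoch_Suc power_add power_mult) (simp add: mult.assoc)
qed

section \<open>Multisets as weakly decreasing lists\<close>

definition dlist :: "nat multiset \<Rightarrow> nat list" where
  "dlist b = rev (sorted_list_of_multiset b)"

lemma mset_dlist [simp]: "mset (dlist b) = b"
  by (simp add: dlist_def)

lemma length_dlist [simp]: "length (dlist b) = size b"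
  by (metis mset_dlist size_mset)

lemma dlist_antimono: "i \<le> j \<Longrightarrow> j < size b \<Longrightarrow> dlist b ! j \<le> dlist b ! i"
  using sorted_sorted_list_of_multiset[of b]
  by (metis dlist_def length_dlist sorted_wrt_rev sorted_rev_nth_mono rev_rev_ident)

lemma dlist_eqI:
  assumes "mset xs = b" "\<And>i. Suc i < length xs \<Longrightarrow> xs ! Suc i \<le> xs ! i"
  shows "dlist b = xs"
proof -
  have "sorted_wrt (\<ge>) xs"
    using assms(2) by (subst sorted_wrt_iff_nth_Suc_transp) (auto intro: transpI)
  then have "sorted (rev xs)" by (simp add: sorted_wrt_rev)
  then show ?thesis unfolding dlist_def
    using assms(1) by (metis mset_rev rev_rev_ident sorted_list_of_multiset_mset sorted_sort_id)
qed

text \<open>A weakly decreasing list is recovered from its multiset by \<open>dlist\<close>. The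
  bound on \<open>D\<close> excludes position \<open>n\<close>, so the last entry is an arbitrary
  natural number.\<close>

lemma chains_bij:
  assumes "D \<subseteq> {1..<n}"
  shows "bij_betw mset (descent_chains n D) {b. size b = n \<and> (\<forall>i\<in>D. dlist b ! (i - 1) > dlist b ! i)}"
proof (rule bij_betwI[where g = dlist])
  have eq: "dlist (mset c) = c" if "c \<in> descent_chains n D" for c
  proof (rule dlist_eqI)
    fix i assume "Suc i < length c"
    moreover from that have "length c = n" "(if Suc i < n then c ! Suc i else 0) + of_bool (Suc i \<in> D) \<le> c ! i"
      if "i < n" unfolding mem_descent_chains_iff using that by blast+
    ultimately show "c ! Suc i \<le> c ! i" using that by (auto simp: mem_descent_chains_iff)
  qed simp
  show "dlist (mset c) = c" if "c \<in> descent_chains n D" for c by (rule eq[OF that])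
  show "mset \<in> descent_chains n D \<rightarrow> {b. size b = n \<and> (\<forall>i\<in>D. dlist b ! (i - 1) > dlist b ! i)}"
  proof (intro funcsetI CollectI conjI ballI)
    fix c i assume c: "c \<in> descent_chains n D" and i: "i \<in> D"
    have "i \<in> {1..<n}" using assms i by blast
    then obtain i' where i': "i = Suc i'" "Suc i' < n" by (cases i) auto
    from c have "(if Suc i' < n then c ! Suc i' else 0) + of_bool (Suc i' \<in> D) \<le> c ! i'"
      unfolding mem_descent_chains_iff using i'(2) Suc_lessD by blast
    with i' i have "c ! Suc i' < c ! i'" by simp
    then show "dlist (mset c) ! (i - 1) > dlist (mset c) ! i" using i i' by (simp add: eq[OF c])
  qed (auto simp: mem_descent_chains_iff)
  show "dlist \<in> {b. size b = n \<and> (\<forall>i\<in>D. dlist b ! (i - 1) > dlist b ! i)} \<rightarrow> descent_chains n D"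
  proof (intro funcsetI)
    fix b assume b: "b \<in> {b. size b = n \<and> (\<forall>i\<in>D. dlist b ! (i - 1) > dlist b ! i)}"
    have "(if Suc i < n then dlist b ! Suc i else 0) + of_bool (Suc i \<in> D) \<le> dlist b ! i" if "i < n" for i
    proof (cases "Suc i \<in> D")
      case True
      then have "dlist b ! Suc i < dlist b ! i" using b by fastforce
      moreover have "Suc i < n" using True assms by (meson atLeastLessThan_iff subsetD)
      ultimately show ?thesis using True by simp
    next
      case False
      then show ?thesis using dlist_antimono[of i "Suc i" b] b by auto
    qed
    then show "dlist b \<in> descent_chains n D" using b by (simp add: mem_descent_chains_iff)
  qed
qed simp

section \<open>Generating functions over multisets of a given size\<close>

text \<open>A relation rather than a value, so that two evaluations for the same \<open>f\<close>
  are compared by uniqueness of sums.\<close>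

definition q_has_sum :: "real \<Rightarrow> (nat multiset \<Rightarrow> real) \<Rightarrow> nat \<Rightarrow> real \<Rightarrow> bool" where
  "q_has_sum q f n x \<longleftrightarrow> ((\<lambda>b. q ^ sum_mset b * f b) has_sum x) {b. size b = n}"

lemma q_has_sum_unique: "q_has_sum q f n x \<Longrightarrow> q_has_sum q f n y \<Longrightarrow> x = y"
  unfolding q_has_sum_def by (rule has_sum_unique)

lemma q_has_sum_cong: "(\<And>b. size b = n \<Longrightarrow> f b = g b) \<Longrightarrow> q_has_sum q f n x \<longleftrightarrow> q_has_sum q g n x"
  unfolding q_has_sum_def by (intro has_sum_cong) auto

lemma q_has_sum_cmult: "q_has_sum q f n x \<Longrightarrow> q_has_sum q (\<lambda>b. a * f b) n (a * x)"
  unfolding q_has_sum_def by (drule has_sum_cmult_right[where c = a]) (simp add: mult.left_commute)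

lemma q_has_sum_add:
  "q_has_sum q f n x \<Longrightarrow> q_has_sum q g n y \<Longrightarrow> q_has_sum q (\<lambda>b. f b + g b) n (x + y)"
  unfolding q_has_sum_def by (simp add: distrib_left has_sum_add)

lemma q_has_sum_sum:
  "(\<And>i. i \<in> I \<Longrightarrow> q_has_sum q (f i) n (x i)) \<Longrightarrow> q_has_sum q (\<lambda>b. \<Sum>i\<in>I. f i b) n (\<Sum>i\<in>I. x i)"
  by (induction I rule: infinite_finite_induct) (auto intro!: q_has_sum_add simp: q_has_sum_def[of _ "\<lambda>_. 0"])

lemma q_has_sum_chains:
  assumes "0 < q" "q < 1" "D \<subseteq> {1..<n}"
  shows "q_has_sum q (\<lambda>b. of_bool (\<forall>i\<in>D. dlist b ! (i - 1) > dlist b ! i)) n (q ^ (\<Sum>i\<in>D. i) / qpoch q n)"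
proof -
  let ?B = "{b. size b = n \<and> (\<forall>i\<in>D. dlist b ! (i - 1) > dlist b ! i)}"
  have "D \<inter> {1..n} = D" using assms(3) by auto
  then have "((\<lambda>c. q ^ sum_list c) has_sum (q ^ (\<Sum>i\<in>D. i) / qpoch q n)) (descent_chains n D)"
    using has_sum_chains[OF assms(1,2), where D = D and n = n] by simp
  then have "((\<lambda>c. q ^ sum_mset (mset c)) has_sum (q ^ (\<Sum>i\<in>D. i) / qpoch q n)) (descent_chains n D)"
    by (simp add: sum_mset_sum_list)
  then have "((\<lambda>b. q ^ sum_mset b) has_sum (q ^ (\<Sum>i\<in>D. i) / qpoch q n)) ?B"
    using has_sum_reindex_bij_betw[OF chains_bij[OF assms(3)], of "\<lambda>b. q ^ sum_mset b"] by simp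
  then show ?thesis unfolding q_has_sum_def
    by (rule has_sum_cong_neutral[THEN iffD1, rotated -1]) auto
qed

lemma q_has_sum_1:
  assumes "0 < q" "q < 1"
  shows "q_has_sum q (\<lambda>b. 1) n (1 / qpoch q n)"
  using q_has_sum_chains[OF assms, of "{}" n] by simp

lemma finite_submultisets: "finite {c. c \<subseteq># (b :: 'a multiset)}"
proof (rule finite_subset)
  show "{c. c \<subseteq># b} \<subseteq> mset ` {xs. set xs \<subseteq> set_mset b \<and> length xs \<le> size b}"
  proof
    fix c assume "c \<in> {c. c \<subseteq># b}"
    moreover obtain xs where "c = mset xs" using ex_mset[of c] by auto
    ultimately show "c \<in> mset ` {xs. set xs \<subseteq> set_mset b \<and> length xs \<le> size b}"
      using set_mset_mono[of c b] size_mset_mono[of c b] by auto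
  qed
qed (simp add: finite_lists_length_le)

text \<open>A pair of \<open>b\<close> and a submultiset \<open>c\<close> of size \<open>m\<close>
  is the same as an independent pair of multisets \<open>c\<close> and \<open>b - c\<close>, and the
  weight \<open>q ^ sum_mset b\<close> factors accordingly. Summing over \<open>b - c\<close> gives
  the factor \<open>1 / qpoch q (n - m)\<close>; this is the source of the q-binomial
  coefficients.\<close>

lemma q_has_sum_submultisets:
  assumes q: "0 < q" "q < 1" and "m \<le> n" and f: "q_has_sum q f m x" and nonneg: "\<And>b. f b \<ge> 0"
  shows "q_has_sum q (\<lambda>b. \<Sum>c | c \<subseteq># b \<and> size c = m. f c) n (x / qpoch q (n - m))"
  unfolding q_has_sum_def
proof (rule has_sum_SigmaD[where f = "\<lambda>(b, c). q ^ sum_mset b * f c"])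
  have "((\<lambda>(c, d). (q ^ sum_mset c * f c) * (q ^ sum_mset d * 1)) has_sum (x * (1 / qpoch q (n - m))))
      ({c. size c = m} \<times> {d. size d = n - m})"
    using f q_has_sum_1[OF q, of "n - m"] unfolding q_has_sum_def
    by (rule has_sum_Times_nonneg) (use q nonneg in auto)
  then show "((\<lambda>(b, c). q ^ sum_mset b * f c) has_sum (x / qpoch q (n - m)))
      (SIGMA b:{b. size b = n}. {c. c \<subseteq># b \<and> size c = m})"
    by (subst has_sum_reindex_bij_witness[where i = "\<lambda>(c, d). (c + d, c)" and j = "\<lambda>(b, c). (c, b - c)"
          and T = "{c. size c = m} \<times> {d. size d = n - m}"
          and h = "\<lambda>(c, d). (q ^ sum_mset c * f c) * (q ^ sum_mset d * 1)", OF _ _ _ _ _ refl])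
       (use \<open>m \<le> n\<close> in \<open>auto simp: size_Diff_submset power_add[symmetric] sum_mset.union[symmetric]
          simp del: sum_mset.union\<close>)
next
  fix b :: "nat multiset"
  have "finite {c. c \<subseteq># b \<and> size c = m}" using finite_submultisets[of b] by simp
  then show "((\<lambda>c. (\<lambda>(b, c). q ^ sum_mset b * f c) (b, c)) has_sum (q ^ sum_mset b * (\<Sum>c | c \<subseteq># b \<and> size c = m. f c)))
      {c. c \<subseteq># b \<and> size c = m}"
    by (auto intro!: has_sum_finiteI simp: sum_distrib_left)
qed

section \<open>Sums over words with a given content\<close>

text \<open>The coefficient of \<open>x^b\<close> in the product of the linear forms \<open>\<Sum>y. w y * x_y\<close>, where \<open>w\<close> runs through the list.\<close>

fun word_sum :: "(nat \<Rightarrow> real) list \<Rightarrow> nat multiset \<Rightarrow> real" where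
  "word_sum [] b = of_bool (b = {#})"
| "word_sum (w # ws) b = (\<Sum>y\<in>set_mset b. w y * word_sum ws (b - {#y#}))"

lemma word_sum_cong:
  assumes "list_all2 (\<lambda>w w'. \<forall>y\<in>#b. w y = w' y) ws ws'"
  shows "word_sum ws b = word_sum ws' b"
  using assms
proof (induction ws arbitrary: ws' b)
  case (Cons w ws)
  then obtain u us where us: "ws' = u # us" "\<forall>y\<in>#b. w y = u y"
    "list_all2 (\<lambda>w w'. \<forall>y\<in>#b. w y = w' y) ws us"
    by (auto simp: list_all2_Cons1)
  have "word_sum ws (b - {#y#}) = word_sum us (b - {#y#})" for y
    by (rule Cons.IH, rule list_all2_mono[OF us(3)]) (auto dest: in_diffD)
  with us show ?case by simp
qed simp

text \<open>Linear forms commute: exchanging the first two letters is an involution on the pairs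
  that can be drawn from \<open>b\<close>.\<close>

lemma word_sum_swap: "word_sum (w # w' # ws) b = word_sum (w' # w # ws) b"
proof -
  have "word_sum (u # u' # ws) b =
      (\<Sum>(y, z)\<in>(SIGMA y:set_mset b. set_mset (b - {#y#})). u y * u' z * word_sum ws (b - {#y#} - {#z#}))" for u u'
    by (simp add: sum.Sigma[symmetric] sum_distrib_left mult.assoc)
  moreover have "(\<Sum>(y, z)\<in>(SIGMA y:set_mset b. set_mset (b - {#y#})). w y * w' z * word_sum ws (b - {#y#} - {#z#}))
      = (\<Sum>(y, z)\<in>(SIGMA y:set_mset b. set_mset (b - {#y#})). w' y * w z * word_sum ws (b - {#y#} - {#z#}))"
    by (rule sum.reindex_bij_witness[where i = prod.swap and j = prod.swap])
       (auto simp: in_diff_count add_mset_commute mult.commute split: if_splits)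
  ultimately show ?thesis by simp
qed

lemma word_sum_Cons_cong: "(\<And>b. word_sum ws b = word_sum ws' b) \<Longrightarrow> word_sum (w # ws) b = word_sum (w # ws') b"
  by simp

lemma word_sum_move: "word_sum (us @ w # ws) b = word_sum (w # us @ ws) b"
proof (induction us arbitrary: b)
  case (Cons u us)
  have "word_sum (u # us @ w # ws) b = word_sum (u # w # us @ ws) b"
    by (rule word_sum_Cons_cong) (rule Cons.IH)
  then show ?case using word_sum_swap[of u w "us @ ws" b] by simp
qed simp

lemma word_sum_perm: "mset ws = mset ws' \<Longrightarrow> word_sum ws b = word_sum ws' b"
proof (induction ws arbitrary: ws' b)
  case (Cons w ws)
  then have "w \<in> set ws'" by (metis list.set_intros(1) mset_eq_setD)
  then obtain us vs where ws': "ws' = us @ w # vs" by (meson split_list)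
  with Cons.prems have "mset ws = mset (us @ vs)" by simp
  then have "word_sum (w # ws) b = word_sum (w # us @ vs) b"
    by (intro word_sum_Cons_cong Cons.IH)
  then show ?case by (simp only: ws' word_sum_move)
qed simp

lemma word_sum_delta:
  "word_sum ((\<lambda>y. w y - a * of_bool (y = j)) # ws) b =
     word_sum (w # ws) b - a * (if j \<in># b then word_sum ws (b - {#j#}) else 0)"
  by (simp add: left_diff_distrib sum_subtractf mult.assoc sum_distrib_left[symmetric] if_distrib[of "\<lambda>x. x * _"]
      of_bool_def sum.delta cong: if_cong)

section \<open>Alternating sums over subsets of the support\<close>

text \<open>If F is the formal power series with coefficients \<open>f\<close>, this is the
  coefficient of x^b in F times the product of all factors 1 - a x_y.\<close>

definition alt_sum :: "(nat multiset \<Rightarrow> real) \<Rightarrow> real \<Rightarrow> nat multiset \<Rightarrow> real" where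
  "alt_sum f a b = (\<Sum>S\<in>Pow (set_mset b). (- a) ^ card S * f (b - mset_set S))"

lemma sum_Pow_insert:
  assumes "finite A" "x \<notin> A"
  shows "(\<Sum>S\<in>Pow (insert x A). f S) = (\<Sum>S\<in>Pow A. f S) + (\<Sum>S\<in>Pow A. f (insert x S))"
proof -
  have "inj_on (insert x) (Pow A)" using assms(2) by (auto simp: inj_on_def)
  then show ?thesis unfolding Pow_insert
    using assms by (subst sum.union_disjoint) (auto simp: sum.reindex)
qed

text \<open>Expansion of the product, where \<open>S\<close> collects the letters \<open>j\<close>
  at which the summand -a x_j is chosen; every such choice removes one \<open>j\<close> from
  \<open>b\<close>. A form \<open>w j\<close> that is kept moves behind the remaining ones, hence
  the induction with varying \<open>ws\<close>.\<close>

lemma word_sum_expand: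
  assumes "distinct js" "set js \<subseteq> set_mset b"
  shows "word_sum (map (\<lambda>j y. w j y - a * of_bool (y = j)) js @ ws) b =
    (\<Sum>S\<in>Pow (set js). (- a) ^ card S * word_sum (map w (filter (\<lambda>j. j \<notin> S) js) @ ws) (b - mset_set S))"
  using assms
proof (induction js arbitrary: ws b)
  case (Cons j js)
  let ?d = "map (\<lambda>j y. w j y - a * of_bool (y = j)) js"
  have j: "j \<notin> set js" "j \<in># b" using Cons.prems by auto
  have "word_sum (map (\<lambda>j y. w j y - a * of_bool (y = j)) (j # js) @ ws) b =
      word_sum (w j # ?d @ ws) b - a * word_sum (?d @ ws) (b - {#j#})"
    using j by (simp only: list.map append_Cons word_sum_delta if_True)
  also have "word_sum (w j # ?d @ ws) b = word_sum (?d @ w j # ws) b"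
    by (simp only: word_sum_move)
  also have "\<dots> = (\<Sum>S\<in>Pow (set js). (- a) ^ card S *
      word_sum (map w (filter (\<lambda>j. j \<notin> S) js) @ w j # ws) (b - mset_set S))"
    using Cons.prems by (intro Cons.IH) auto
  also have "\<dots> = (\<Sum>S\<in>Pow (set js). (- a) ^ card S *
      word_sum (map w (filter (\<lambda>j. j \<notin> S) (j # js)) @ ws) (b - mset_set S))"
    using j by (intro sum.cong refl) (auto simp: word_sum_move simp del: word_sum.simps)
  moreover have "word_sum (?d @ ws) (b - {#j#}) = (\<Sum>S\<in>Pow (set js). (- a) ^ card S *
      word_sum (map w (filter (\<lambda>j. j \<notin> S) js) @ ws) (b - {#j#} - mset_set S))"
    using Cons.prems by (intro Cons.IH) (auto simp: in_diff_count)
  moreover have "- a * (\<Sum>S\<in>Pow (set js). (- a) ^ card S *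
      word_sum (map w (filter (\<lambda>j. j \<notin> S) js) @ ws) (b - {#j#} - mset_set S)) =
      (\<Sum>S\<in>Pow (set js). (- a) ^ card (insert j S) *
      word_sum (map w (filter (\<lambda>i. i \<notin> insert j S) (j # js)) @ ws) (b - mset_set (insert j S)))"
    unfolding sum_distrib_left
  proof (intro sum.cong refl)
    fix S assume "S \<in> Pow (set js)"
    then have S: "finite S" "j \<notin> S" using j finite_subset[of S "set js"] by auto
    have "filter (\<lambda>i. i \<notin> insert j S) (j # js) = filter (\<lambda>j. j \<notin> S) js"
      using j(1) by (auto intro!: filter_cong)
    moreover have "b - mset_set (insert j S) = b - {#j#} - mset_set S"
      using S by simp
    ultimately show "- a * ((- a) ^ card S * word_sum (map w (filter (\<lambda>j. j \<notin> S) js) @ ws) (b - {#j#} - mset_set S)) =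
       (- a) ^ card (insert j S) *
      word_sum (map w (filter (\<lambda>i. i \<notin> insert j S) (j # js)) @ ws) (b - mset_set (insert j S))"
      using S by simp
  qed
  ultimately have "word_sum (map (\<lambda>j y. w j y - a * of_bool (y = j)) (j # js) @ ws) b =
      (\<Sum>S\<in>Pow (set js). (- a) ^ card S *
        word_sum (map w (filter (\<lambda>j. j \<notin> S) (j # js)) @ ws) (b - mset_set S)) +
      (\<Sum>S\<in>Pow (set js). (- a) ^ card (insert j S) *
        word_sum (map w (filter (\<lambda>i. i \<notin> insert j S) (j # js)) @ ws) (b - mset_set (insert j S)))"
    by (simp only: diff_conv_add_uminus mult_minus_left)
  then show ?case using j by (simp only: list.set sum_Pow_insert finite_set not_False_eq_True)
qed simp

section \<open>The linear forms and the coefficients M and N\<close>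

text \<open>The values count colored letters: a letter above \<open>j\<close> is barred and has
  weight \<open>t\<close>, a letter below \<open>j\<close> is unbarred and has weight 1, and
  \<open>j\<close> itself may have either color.\<close>

definition L_weight :: "real \<Rightarrow> nat \<Rightarrow> nat \<Rightarrow> real" where
  "L_weight t j y = (if y > j then t else if y = j then 1 + t else 1)"

definition A_weight :: "real \<Rightarrow> nat \<Rightarrow> nat \<Rightarrow> real" where
  "A_weight t j y = (if y > j then t else 1)"

definition B_weight :: "real \<Rightarrow> nat \<Rightarrow> nat \<Rightarrow> real" where
  "B_weight t j y = (if y \<ge> j then t else 1)"

definition M_coeff :: "real \<Rightarrow> nat multiset \<Rightarrow> real" where
  "M_coeff t b = word_sum (map (L_weight t) (dlist b)) b"

text \<open>The one copy of each letter that receives \<open>A_weight\<close> corresponds to the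
  start of its block in the sorted list; see \<open>N_coeff_positions\<close>.\<close>

definition N_coeff :: "real \<Rightarrow> nat multiset \<Rightarrow> real" where
  "N_coeff t b = word_sum (map (A_weight t) (rev (sorted_list_of_set (set_mset b))) @
     map (L_weight t) (dlist (b - mset_set (set_mset b)))) b"

text \<open>The forms for \<open>b\<close> split into one copy of each distinct letter, where x_j is
  subtracted \<open>a\<close> times, and the remaining copies. Expanding the first group by
  \<open>word_sum_expand\<close> produces the alternating sum.\<close>

lemma alt_sum_M_coeff:
  "alt_sum (M_coeff t) a b = word_sum (map (\<lambda>j y. L_weight t j y - a * of_bool (y = j))
     (rev (sorted_list_of_set (set_mset b))) @ map (L_weight t) (dlist (b - mset_set (set_mset b)))) b"
proof -
  let ?js = "rev (sorted_list_of_set (set_mset b))" and ?ws = "map (L_weight t) (dlist (b - mset_set (set_mset b)))"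
  have "word_sum (map (L_weight t) (filter (\<lambda>j. j \<notin> S) ?js) @ ?ws) (b - mset_set S) = M_coeff t (b - mset_set S)"
    if "S \<subseteq> set_mset b" for S
  proof -
    have "finite S" using that finite_subset by blast
    \<comment> \<open>Dropping \<open>S\<close> from the distinct letters and adding back the other
      copies leaves \<open>b - mset_set S\<close>; the order of the forms is immaterial.\<close>
    have "mset (filter (\<lambda>j. j \<notin> S) ?js @ dlist (b - mset_set (set_mset b))) = b - mset_set S"
    proof (rule multiset_eqI)
      fix x
      have "mset ?js = mset_set (set_mset b)"
        by (metis finite_set_mset mset_rev mset_sorted_list_of_multiset sorted_list_of_mset_set)
      then show "count (mset (filter (\<lambda>j. j \<notin> S) ?js @ dlist (b - mset_set (set_mset b)))) x = count (b - mset_set S) x"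
        using that \<open>finite S\<close> count_greater_zero_iff[of b x]
        by (auto simp: count_mset_set' not_in_iff mset_filter simp del: count_greater_zero_iff)
    qed
    then show ?thesis unfolding M_coeff_def map_append[symmetric]
      by (intro word_sum_perm) (simp only: mset_map mset_dlist)
  qed
  then show ?thesis unfolding alt_sum_def by (subst word_sum_expand) auto
qed

lemma L_weight_minus_delta:
  "(\<lambda>y. L_weight t j y - t * of_bool (y = j)) = A_weight t j"
  "(\<lambda>y. L_weight t j y - 1 * of_bool (y = j)) = B_weight t j"
  by (auto simp: L_weight_def A_weight_def B_weight_def)

lemma N_coeff_eq: "N_coeff t b = alt_sum (M_coeff t) t b"
  unfolding alt_sum_M_coeff L_weight_minus_delta N_coeff_def ..

text \<open>On the letters occurring in \<open>js\<close>, each \<open>B_weight\<close> is the \<open>A_weight\<close> of the next smaller letter;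
  the two weights left over are the constants \<open>t\<close> and \<open>1\<close>.\<close>

lemma word_sum_B_weight:
  assumes "sorted_wrt (>) js" "js \<noteq> []" "set_mset b \<subseteq> set js"
  shows "word_sum (map (B_weight t) js @ ws) b = t * word_sum (map (A_weight t) js @ ws) b"
proof -
  have sorted: "js ! i > js ! k \<longleftrightarrow> i < k" if "i < length js" "k < length js" for i k
    using assms(1) that by (metis linorder_neqE_nat order_less_asym sorted_wrt_nth_less)
  have "word_sum (map (B_weight t) js @ ws) b = word_sum ((map (A_weight t) (tl js) @ [\<lambda>_. t]) @ ws) b"
  proof (rule word_sum_cong, intro list_all2_appendI list_all2_all_nthI ballI)
    fix k y assume k: "k < length (map (B_weight t) js)" and "y \<in># b"
    then obtain i where i: "y = js ! i" "i < length js" using assms(3) by (metis in_set_conv_nth subsetD)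
    have le: "js ! k \<le> js ! i \<longleftrightarrow> i \<le> k" using sorted[of k i] sorted[of i k] k i by auto
    show "(map (B_weight t) js ! k) y = ((map (A_weight t) (tl js) @ [\<lambda>_. t]) ! k) y"
    proof (cases "Suc k < length js")
      case True
      then show ?thesis using i k le sorted[of i "Suc k"]
        by (auto simp: nth_append nth_tl B_weight_def A_weight_def)
    next
      case False
      then show ?thesis using i k le by (auto simp: nth_append B_weight_def)
    qed
  qed (use assms(2) in \<open>auto simp: list_all2_refl\<close>)
  also have "\<dots> = word_sum ((\<lambda>_. t) # map (A_weight t) (tl js) @ ws) b"
    using word_sum_move[of "map (A_weight t) (tl js)" "\<lambda>_. t" ws b] by simp
  also have "\<dots> = t * word_sum ((\<lambda>_. 1) # map (A_weight t) (tl js) @ ws) b"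
    by (simp add: sum_distrib_left)
  also have "word_sum ((\<lambda>_. 1) # map (A_weight t) (tl js) @ ws) b = word_sum (map (A_weight t) js @ ws) b"
  proof -
    have "map (A_weight t) js @ ws = A_weight t (hd js) # map (A_weight t) (tl js) @ ws"
      using assms(2) by (cases js) auto
    moreover have "A_weight t (hd js) y = 1" if "y \<in># b" for y
    proof -
      have "y \<in> set js" using assms(3) that by blast
      then obtain i where "i < length js" "y = js ! i" by (auto simp: in_set_conv_nth)
      then show ?thesis using sorted[of i 0] assms(2) by (simp add: A_weight_def hd_conv_nth)
    qed
    ultimately show ?thesis by simp
  qed
  finally show ?thesis .
qed

text \<open>At \<open>a = 1\<close> the forms of the distinct letters are the
  \<open>B_weight\<close> ones, which the cyclic shift turns into \<open>t\<close> times the product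
  that defines \<open>N_coeff\<close>.\<close>

lemma alt_sum_M_coeff_1:
  assumes "b \<noteq> {#}"
  shows "alt_sum (M_coeff t) 1 b = t * N_coeff t b"
  unfolding alt_sum_M_coeff L_weight_minus_delta N_coeff_def
  using assms by (intro word_sum_B_weight) (auto simp: sorted_wrt_rev)

section \<open>Words without double ascents\<close>

text \<open>An ascent consumes two letters and contributes \<open>t\<close>, any other letter
  contributes \<open>1 + t\<close>, and a double ascent gives 0. Thus a word of length n without
  double ascents has weight t^asc (1 + t)^(n - 2 asc).\<close>

fun asc_weight :: "real \<Rightarrow> nat list \<Rightarrow> real" where
  "asc_weight t [] = 1"
| "asc_weight t [x] = 1 + t"
| "asc_weight t (x # y # v) =
     (if x < y then (if v \<noteq> [] \<and> y < hd v then 0 else t * asc_weight t v) else (1 + t) * asc_weight t (y # v))"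

definition R_coeff :: "real \<Rightarrow> nat multiset \<Rightarrow> real" where
  "R_coeff t b = (\<Sum>v\<in>permutations_of_multiset b. asc_weight t v)"

text \<open>Sums (-a)^|u| times the \<open>asc_weight\<close> of the rest over all strictly
  increasing prefixes u whose letters are at least \<open>p\<close>, the empty prefix
  included.\<close>

fun prefix_sum :: "real \<Rightarrow> real \<Rightarrow> nat \<Rightarrow> nat list \<Rightarrow> real" where
  "prefix_sum t a p [] = 1"
| "prefix_sum t a p (y # v) = asc_weight t (y # v) + (if p \<le> y then - a * prefix_sum t a (Suc y) v else 0)"

lemma prefix_sum_Cons:
  assumes "a = 1 \<or> a = t" "p \<le> x"
  shows "prefix_sum t a p (x # v) = (if v \<noteq> [] \<and> x < hd v then 0 else (1 + t - a) * asc_weight t v)"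
  using assms(2)
proof (induction v arbitrary: x p)
  case (Cons y v)
  show ?case
  proof (cases "x < y")
    case True
    then have "prefix_sum t a (Suc x) (y # v) = (if v \<noteq> [] \<and> y < hd v then 0 else (1 + t - a) * asc_weight t v)"
      by (intro Cons.IH) simp
    then show ?thesis using True Cons.prems assms(1) by (auto simp: algebra_simps)
  qed (use Cons.prems in \<open>auto simp: algebra_simps\<close>)
qed simp

lemma sum_permutations_of_multiset:
  assumes "b \<noteq> {#}"
  shows "(\<Sum>v\<in>permutations_of_multiset b. f v) =
    (\<Sum>y\<in>set_mset b. \<Sum>v\<in>permutations_of_multiset (b - {#y#}). f (y # v))"
proof -
  have "permutations_of_multiset b = (\<Union>y\<in>set_mset b. (#) y ` permutations_of_multiset (b - {#y#}))"
    using assms by (rule permutations_of_multiset_nonempty)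
  then have "(\<Sum>v\<in>permutations_of_multiset b. f v) =
      (\<Sum>y\<in>set_mset b. \<Sum>v\<in>(#) y ` permutations_of_multiset (b - {#y#}). f v)"
    by (simp only:) (intro sum.UNION_disjoint, auto)
  then show ?thesis by (simp add: sum.reindex)
qed

text \<open>Sorting the nonempty subsets by their minimum matches the recursion of
  \<open>prefix_sum\<close>.\<close>

lemma sum_Pow_Min:
  fixes B :: "nat set"
  assumes "finite B"
  shows "(\<Sum>S\<in>Pow {y \<in> B. p \<le> y}. g S) =
    g {} + (\<Sum>y\<in>{y \<in> B. p \<le> y}. \<Sum>S\<in>Pow {z \<in> B. Suc y \<le> z}. g (insert y S))"
proof -
  let ?P = "Pow {y \<in> B. p \<le> y}"
  have "(\<Sum>S\<in>?P. g S) = g {} + (\<Sum>S\<in>?P - {{}}. g S)"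
    using assms by (subst sum.remove[where x = "{}"]) auto
  also have "(\<Sum>S\<in>?P - {{}}. g S) =
      (\<Sum>(y, S)\<in>(SIGMA y:{y \<in> B. p \<le> y}. Pow {z \<in> B. Suc y \<le> z}). g (insert y S))"
  proof (rule sum.reindex_bij_witness[where i = "\<lambda>(y, S). insert y S" and j = "\<lambda>S. (Min S, S - {Min S})"])
    fix S assume S: "S \<in> ?P - {{}}"
    then have "finite S" "S \<noteq> {}" using assms by (auto intro: finite_subset)
    then have *: "Min S \<in> S" "\<And>z. z \<in> S \<Longrightarrow> Min S \<le> z" by auto
    then show "(case (Min S, S - {Min S}) of (y, S) \<Rightarrow> insert y S) = S" by auto
    show "(Min S, S - {Min S}) \<in> (SIGMA y:{y \<in> B. p \<le> y}. Pow {z \<in> B. Suc y \<le> z})"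
      using * S by (auto simp: Suc_le_eq order.strict_iff_order)
    then show "(case (Min S, S - {Min S}) of (y, S) \<Rightarrow> g (insert y S)) = g S"
      using * by (simp add: insert_absorb)
  next
    fix x assume x: "x \<in> (SIGMA y:{y \<in> B. p \<le> y}. Pow {z \<in> B. Suc y \<le> z})"
    obtain y S where [simp]: "x = (y, S)" by (cases x)
    have fin: "finite S" using x assms by (auto intro: finite_subset)
    have "Min (insert y S) = y" using x fin by (intro Min_eqI) auto
    moreover have "y \<notin> S" using x by auto
    ultimately show "(Min (case x of (y, S) \<Rightarrow> insert y S), (case x of (y, S) \<Rightarrow> insert y S) -
         {Min (case x of (y, S) \<Rightarrow> insert y S)}) = x" by simp
    show "(case x of (y, S) \<Rightarrow> insert y S) \<in> ?P - {{}}" using x by auto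
  qed
  also have "\<dots> = (\<Sum>y\<in>{y \<in> B. p \<le> y}. \<Sum>S\<in>Pow {z \<in> B. Suc y \<le> z}. g (insert y S))"
    using assms by (subst sum.Sigma) auto
  finally show ?thesis .
qed

text \<open>A set \<open>S\<close> and a word with content \<open>b - mset_set S\<close> are joined
  into one word with content \<open>b\<close> by writing \<open>S\<close> in increasing order in
  front. The induction strips off the smallest element of \<open>S\<close>, which raises
  \<open>p\<close>.\<close>

lemma alt_sum_R_coeff_aux:
  "(\<Sum>S\<in>Pow {y \<in> set_mset b. p \<le> y}. (- a) ^ card S * R_coeff t (b - mset_set S)) =
     (\<Sum>v\<in>permutations_of_multiset b. prefix_sum t a p v)"
proof (induction "size b" arbitrary: b p rule: less_induct)
  case less
  show ?case
  proof (cases "b = {#}")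
    case False
    have "(\<Sum>S\<in>Pow {z \<in> set_mset b. Suc y \<le> z}. (- a) ^ card (insert y S) * R_coeff t (b - mset_set (insert y S))) =
        - a * (\<Sum>v\<in>permutations_of_multiset (b - {#y#}). prefix_sum t a (Suc y) v)" if "y \<in># b" for y
    proof -
      have "{z \<in> set_mset b. Suc y \<le> z} = {z \<in> set_mset (b - {#y#}). Suc y \<le> z}"
        by (auto simp: in_diff_count)
      moreover have "(- a) ^ card (insert y S) * R_coeff t (b - mset_set (insert y S)) =
          - a * ((- a) ^ card S * R_coeff t (b - {#y#} - mset_set S))"
        if "S \<subseteq> {z \<in> set_mset b. Suc y \<le> z}" for S
      proof -
        have "finite S" "y \<notin> S" using that by (auto intro: finite_subset)
        then show ?thesis by simp
      qed
      ultimately show ?thesis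
        using less[of "b - {#y#}" "Suc y"] that size_Suc_Diff1[OF that]
        by (simp add: sum_distrib_left[symmetric] sum_negf)
    qed
    then have "(\<Sum>S\<in>Pow {y \<in> set_mset b. p \<le> y}. (- a) ^ card S * R_coeff t (b - mset_set S)) = R_coeff t b +
        (\<Sum>y\<in>{y \<in> set_mset b. p \<le> y}. - a * (\<Sum>v\<in>permutations_of_multiset (b - {#y#}). prefix_sum t a (Suc y) v))"
      by (subst sum_Pow_Min) auto
    also have "\<dots> = R_coeff t b + (\<Sum>y\<in>set_mset b. if p \<le> y
        then - a * (\<Sum>v\<in>permutations_of_multiset (b - {#y#}). prefix_sum t a (Suc y) v) else 0)"
      by (subst sum.inter_filter) auto
    also have "\<dots> = (\<Sum>v\<in>permutations_of_multiset b. prefix_sum t a p v)"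
      unfolding R_coeff_def sum_permutations_of_multiset[OF False] sum.distrib[symmetric] sum_distrib_left
      by (intro sum.cong refl) (auto simp: sum.distrib sum_distrib_left)
    finally show ?thesis .
  qed (simp add: R_coeff_def)
qed

lemma alt_sum_R_coeff: "alt_sum (R_coeff t) a b = (\<Sum>v\<in>permutations_of_multiset b. prefix_sum t a 0 v)"
  using alt_sum_R_coeff_aux[where b = b and p = 0] by (simp add: alt_sum_def)

text \<open>The factor \<open>1 + t - a\<close> of \<open>prefix_sum_Cons\<close> is
  \<open>t\<close> for \<open>a = 1\<close> and 1 for \<open>a = t\<close>, while the rest does not
  depend on \<open>a\<close>. Hence the relation holds word by word.\<close>

lemma alt_sum_R_coeff_1:
  assumes "b \<noteq> {#}"
  shows "alt_sum (R_coeff t) 1 b = t * alt_sum (R_coeff t) t b"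
  unfolding alt_sum_R_coeff sum_distrib_left
proof (rule sum.cong[OF refl])
  fix v assume "v \<in> permutations_of_multiset b"
  with assms obtain x u where "v = x # u" by (cases v) (auto simp: permutations_of_multiset_def)
  then show "prefix_sum t 1 0 v = t * prefix_sum t t 0 v"
    by (simp add: prefix_sum_Cons del: prefix_sum.simps)
qed

section \<open>The identity M = R and Moebius inversion\<close>

text \<open>The term for the empty set is \<open>f b\<close> in both alternating sums, so the
  relation expresses \<open>(1 - t) * f b\<close> through values at smaller multisets.\<close>

lemma alt_sum_relation_unique:
  assumes "t \<noteq> 1" "f {#} = g {#}"
    and "\<And>b. b \<noteq> {#} \<Longrightarrow> alt_sum f 1 b = t * alt_sum f t b"
    and "\<And>b. b \<noteq> {#} \<Longrightarrow> alt_sum g 1 b = t * alt_sum g t b"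
  shows "f b = g b"
proof (induction "size b" arbitrary: b rule: less_induct)
  case less
  show ?case
  proof (cases "b = {#}")
    case False
    let ?P = "Pow (set_mset b) - {{}}"
    have split: "alt_sum h a b = h b + (\<Sum>S\<in>?P. (- a) ^ card S * h (b - mset_set S))" for h a
      unfolding alt_sum_def by (subst sum.remove[where x = "{}"]) auto
    have "f (b - mset_set S) = g (b - mset_set S)" if "S \<in> ?P" for S
    proof (rule less)
      have "finite S" "S \<noteq> {}" "S \<subseteq> set_mset b" using that by (auto intro: finite_subset)
      moreover from this have "mset_set S \<subseteq># b"
        by (auto simp: subseteq_mset_def count_mset_set')
      ultimately show "size (b - mset_set S) < size b"
        using size_mset_mono[of "mset_set S" b] card_gt_0_iff[of S] by (auto simp: size_Diff_submset)
    qed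
    then have "alt_sum f a b - f b = alt_sum g a b - g b" for a
      unfolding split by (auto intro!: sum.cong)
    from this[of 1] this[of t] have "(1 - t) * f b = (1 - t) * g b"
      unfolding assms(3)[OF False] assms(4)[OF False] by algebra
    then show ?thesis using assms(1) by simp
  qed (simp add: assms(2))
qed

lemma M_coeff_eq_R_coeff: "t \<noteq> 1 \<Longrightarrow> M_coeff t b = R_coeff t b"
  by (rule alt_sum_relation_unique[of t])
     (auto simp: alt_sum_M_coeff_1 N_coeff_eq alt_sum_R_coeff_1, auto simp: M_coeff_def R_coeff_def dlist_def)

lemma sum_Pow_alternating:
  assumes "finite A"
  shows "(\<Sum>S\<in>Pow A. (- 1) ^ card S) = (of_bool (A = {}) :: real)"
proof (cases "A = {}")
  case False
  then obtain x A' where "A = insert x A'" "x \<notin> A'" by (meson Set.set_insert ex_in_conv)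
  with assms have A': "finite A'" "x \<notin> A'" "A = insert x A'" by auto
  have "(\<Sum>S\<in>Pow A'. (- 1) ^ card (insert x S)) = (\<Sum>S\<in>Pow A'. - ((- 1) ^ card S) :: real)"
  proof (intro sum.cong refl)
    fix S assume "S \<in> Pow A'"
    then have "finite S" "x \<notin> S" using A' by (auto intro: finite_subset)
    then show "(- 1) ^ card (insert x S) = (- ((- 1) ^ card S) :: real)" by simp
  qed
  then show ?thesis using A' by (simp add: sum_Pow_insert sum_negf)
qed simp

lemma mset_set_subseteq_iff: "finite S \<Longrightarrow> mset_set S \<subseteq># b \<longleftrightarrow> S \<subseteq> set_mset b"
  by (auto simp: subseteq_mset_def count_mset_set' subset_iff)

text \<open>Moebius inversion on submultisets: for fixed d = c - S the set \<open>S\<close> runs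
  through all subsets of the support of b - d, and the signs cancel unless d = b.\<close>

lemma sum_alt_sum_1: "(\<Sum>c | c \<subseteq># b. alt_sum f 1 c) = f b"
proof -
  have "(\<Sum>c | c \<subseteq># b. alt_sum f 1 c) =
      (\<Sum>(c, S)\<in>(SIGMA c:{c. c \<subseteq># b}. Pow (set_mset c)). (- 1) ^ card S * f (c - mset_set S))"
    unfolding alt_sum_def by (subst sum.Sigma) (auto simp: finite_submultisets)
  also have "\<dots> = (\<Sum>(d, S)\<in>(SIGMA d:{d. d \<subseteq># b}. Pow (set_mset (b - d))). (- 1) ^ card S * f d)"
  proof (rule sum.reindex_bij_witness[where i = "\<lambda>(d, S). (d + mset_set S, S)" and j = "\<lambda>(c, S). (c - mset_set S, S)"])
    fix x assume "x \<in> (SIGMA c:{c. c \<subseteq># b}. Pow (set_mset c))"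
    then obtain c S where x: "x = (c, S)" "c \<subseteq># b" "S \<subseteq> set_mset c" by auto
    then have fin: "finite S" by (auto intro: finite_subset)
    with x have sub: "mset_set S \<subseteq># c" by (simp add: mset_set_subseteq_iff)
    then show "(case case x of (c, S) \<Rightarrow> (c - mset_set S, S) of (d, S) \<Rightarrow> (d + mset_set S, S)) = x"
      using x by simp
    have le: "c - mset_set S \<subseteq># b" using x(2) diff_subset_eq_self subset_mset.order_trans by blast
    moreover have "mset_set S + (c - mset_set S) \<subseteq># b" using sub x(2) by simp
    ultimately have "mset_set S \<subseteq># b - (c - mset_set S)" by (simp only: subset_mset.le_diff_conv2)
    then show "(case x of (c, S) \<Rightarrow> (c - mset_set S, S)) \<in> (SIGMA d:{d. d \<subseteq># b}. Pow (set_mset (b - d)))"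
      using x(1) fin le by (simp add: mset_set_subseteq_iff)
    show "(case case x of (c, S) \<Rightarrow> (c - mset_set S, S) of (d, S) \<Rightarrow> (- 1) ^ card S * f d) =
        (case x of (c, S) \<Rightarrow> (- 1) ^ card S * f (c - mset_set S))" using x by simp
  next
    fix x assume "x \<in> (SIGMA d:{d. d \<subseteq># b}. Pow (set_mset (b - d)))"
    then obtain d S where x: "x = (d, S)" "d \<subseteq># b" "S \<subseteq> set_mset (b - d)" by auto
    then have fin: "finite S" by (auto intro: finite_subset)
    with x have "mset_set S \<subseteq># b - d" by (simp add: mset_set_subseteq_iff)
    then have "d + mset_set S \<subseteq># b"
      by (simp only: subset_mset.le_diff_conv2[OF x(2)] add.commute[of d])
    then show "(case x of (d, S) \<Rightarrow> (d + mset_set S, S)) \<in> (SIGMA c:{c. c \<subseteq># b}. Pow (set_mset c))"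
      using x fin by auto
    show "(case case x of (d, S) \<Rightarrow> (d + mset_set S, S) of (c, S) \<Rightarrow> (c - mset_set S, S)) = x"
      using x by simp
  qed
  also have "\<dots> = (\<Sum>d | d \<subseteq># b. of_bool (b - d = {#}) * f d)"
    by (subst sum.Sigma[symmetric]) (auto simp: finite_submultisets sum_distrib_right[symmetric] sum_Pow_alternating)
  also have "\<dots> = (\<Sum>d\<in>{b}. f d)"
    by (rule sum.mono_neutral_cong_right) (auto simp: finite_submultisets Diff_eq_empty_iff_mset subset_mset.antisym)
  finally show ?thesis by simp
qed

text \<open>Moebius inversion applied to M = R: the empty submultiset contributes 1, any other
  \<open>c\<close> contributes \<open>t * N_coeff t c\<close>.\<close>

lemma R_coeff_eq_sum_N_coeff:
  assumes "t \<noteq> 1"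
  shows "R_coeff t b = 1 + t * (\<Sum>c | c \<subseteq># b \<and> c \<noteq> {#}. N_coeff t c)"
proof -
  have "R_coeff t b = (\<Sum>c | c \<subseteq># b. alt_sum (M_coeff t) 1 c)"
    using sum_alt_sum_1[of "M_coeff t" b] M_coeff_eq_R_coeff[OF assms] by simp
  also have "\<dots> = alt_sum (M_coeff t) 1 {#} + (\<Sum>c | c \<subseteq># b \<and> c \<noteq> {#}. alt_sum (M_coeff t) 1 c)"
    by (subst sum.remove[where x = "{#}"]) (auto simp: finite_submultisets intro!: sum.cong)
  also have "alt_sum (M_coeff t) 1 {#} = 1"
    by (simp add: alt_sum_def M_coeff_def dlist_def)
  finally show ?thesis by (simp add: alt_sum_M_coeff_1 sum_distrib_left)
qed

section \<open>Standardization\<close>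

text \<open>The values of \<open>\<sigma>\<close> are positions of the word \<open>v\<close>, so
  \<open>\<sigma>\<close> is the inverse of a standardization of \<open>v\<close>.\<close>

definition stable_sort :: "nat \<Rightarrow> (nat \<Rightarrow> nat) \<Rightarrow> (nat \<Rightarrow> nat) \<Rightarrow> bool" where
  "stable_sort n v \<sigma> \<longleftrightarrow> \<sigma> permutes {1..n} \<and>
     (\<forall>i\<in>{1..<n}. v (\<sigma> (Suc i)) < v (\<sigma> i) \<or> v (\<sigma> (Suc i)) = v (\<sigma> i) \<and> \<sigma> i < \<sigma> (Suc i))"

lemma stable_sortD:
  assumes "stable_sort n v \<sigma>" "1 \<le> a" "a < b" "b \<le> n"
  shows "v (\<sigma> b) < v (\<sigma> a) \<or> v (\<sigma> b) = v (\<sigma> a) \<and> \<sigma> a < \<sigma> b"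
  using assms(3,4)
proof (induction b rule: less_induct)
  case (less b)
  obtain b' where b': "b = Suc b'" using less.prems by (cases b) auto
  have step: "v (\<sigma> b) < v (\<sigma> b') \<or> v (\<sigma> b) = v (\<sigma> b') \<and> \<sigma> b' < \<sigma> b"
    using assms(1,2) less.prems b' unfolding stable_sort_def by auto
  show ?case
  proof (cases "a = b'")
    case False
    then have "v (\<sigma> b') < v (\<sigma> a) \<or> v (\<sigma> b') = v (\<sigma> a) \<and> \<sigma> a < \<sigma> b'"
      using less.IH[of b'] less.prems b' by auto
    with step show ?thesis by linarith
  qed (use step in simp)
qed

text \<open>The key \<open>K\<close> orders the positions by decreasing letter, equal letters from left to right.\<close>

lemma ex1_stable_sort: "\<exists>!\<sigma>. stable_sort n v \<sigma>"
proof -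
  define B where "B = (\<Sum>k=1..n. v k)"
  \<comment> \<open>\<open>B\<close> bounds all letters, so the subtraction does not truncate;
    positions are smaller than \<open>Suc n\<close>, so letters are compared first and positions
    only break ties.\<close>
  define K where "K k = k + Suc n * (B - v k)" for k
  have B: "v k \<le> B" if "k \<in> {1..n}" for k
    unfolding B_def using that by (intro member_le_sum) auto
  have K_less: "K k < K l \<longleftrightarrow> v l < v k \<or> v l = v k \<and> k < l" if k: "k \<in> {1..n}" and l: "l \<in> {1..n}" for k l
  proof (cases "v l" "v k" rule: linorder_cases)
    case less
    then have "Suc (B - v k) \<le> B - v l" using B[OF k] by simp
    then have "Suc n * Suc (B - v k) \<le> Suc n * (B - v l)" by (intro mult_le_mono) auto
    moreover have "k < Suc n" using k by simp
    ultimately have "K k < K l" unfolding K_def by simp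
    with less show ?thesis by simp
  next
    case greater
    then have "Suc (B - v l) \<le> B - v k" using B[OF l] by simp
    then have "Suc n * Suc (B - v l) \<le> Suc n * (B - v k)" by (intro mult_le_mono) auto
    moreover have "l < Suc n" using l by simp
    ultimately have "K l < K k" unfolding K_def by simp
    with greater show ?thesis by simp
  qed (simp add: K_def)
  have inj: "inj_on K {1..n}"
    by (rule linorder_inj_onI) (use K_less in \<open>auto simp: neq_iff\<close>)
  show ?thesis
  proof (rule ex_ex1I)
    have card: "card (K ` {1..n}) = n" using inj by (simp add: card_image)
    obtain h where h: "bij_betw h {..<n} (K ` {1..n})" "strict_mono_on {..<n} h"
      using ex_bij_betw_strict_mono_card[of "K ` {1..n}"] card by auto
    define \<sigma> where "\<sigma> i = (if i \<in> {1..n} then the_inv_into {1..n} K (h (i - 1)) else i)" for i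
    have "bij_betw (\<lambda>i. i - 1) {1..n} {..<n}"
      by (rule bij_betwI[where g = Suc]) auto
    then have "bij_betw (the_inv_into {1..n} K \<circ> (h \<circ> (\<lambda>i. i - 1))) {1..n} {1..n}"
      using h(1) bij_betw_the_inv_into[OF inj_on_imp_bij_betw[OF inj]] by (blast intro: bij_betw_trans)
    then have "bij_betw \<sigma> {1..n} {1..n}"
      by (rule bij_betw_cong[THEN iffD1, rotated]) (simp add: \<sigma>_def)
    then have perm: "\<sigma> permutes {1..n}"
      by (rule bij_imp_permutes) (simp only: \<sigma>_def if_False)
    have K\<sigma>: "K (\<sigma> i) = h (i - 1)" if "i \<in> {1..n}" for i
    proof -
      have "h (i - 1) \<in> K ` {1..n}" using that h(1) by (auto simp: bij_betw_def)
      then show ?thesis using that inj by (simp add: \<sigma>_def f_the_inv_into_f)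
    qed
    have "stable_sort n v \<sigma>" unfolding stable_sort_def
    proof (intro conjI perm ballI)
      fix i assume i: "i \<in> {1..<n}"
      then have mem: "\<sigma> i \<in> {1..n}" "\<sigma> (Suc i) \<in> {1..n}"
        using permutes_in_image[OF perm, of i] permutes_in_image[OF perm, of "Suc i"] by simp_all
      have "K (\<sigma> i) < K (\<sigma> (Suc i))"
        using i strict_mono_onD[OF h(2), of "i - 1" i] by (auto simp: K\<sigma>)
      then show "v (\<sigma> (Suc i)) < v (\<sigma> i) \<or> v (\<sigma> (Suc i)) = v (\<sigma> i) \<and> \<sigma> i < \<sigma> (Suc i)"
        using K_less[OF mem] by simp
    qed
    then show "\<exists>\<sigma>. stable_sort n v \<sigma>" by blast
  next
    fix \<sigma> \<tau> assume *: "stable_sort n v \<sigma>" "stable_sort n v \<tau>"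
    \<comment> \<open>Uniqueness: the keys along a stable sort form the strictly increasing list of
      a fixed set.\<close>
    have list: "sorted_wrt (<) (map (\<lambda>i. K (\<rho> i)) [1..<Suc n]) \<and> set (map (\<lambda>i. K (\<rho> i)) [1..<Suc n]) = K ` {1..n}"
      if "stable_sort n v \<rho>" for \<rho>
    proof
      have perm: "\<rho> permutes {1..n}" using that by (simp add: stable_sort_def)
      have "K (\<rho> a) < K (\<rho> b)" if "a \<in> {1..n}" "b \<in> {1..n}" "a < b" for a b
      proof -
        have "\<rho> a \<in> {1..n}" "\<rho> b \<in> {1..n}"
          using that permutes_in_image[OF perm] by simp_all
        then show ?thesis using stable_sortD[OF \<open>stable_sort n v \<rho>\<close>, of a b] that K_less by auto
      qed
      then show "sorted_wrt (<) (map (\<lambda>i. K (\<rho> i)) [1..<Suc n])"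
        by (auto simp: sorted_wrt_iff_nth_less simp del: upt_Suc)
      have "K ` \<rho> ` {1..n} = K ` {1..n}" by (simp only: permutes_image[OF perm])
      then show "set (map (\<lambda>i. K (\<rho> i)) [1..<Suc n]) = K ` {1..n}"
        by (simp add: image_image atLeastLessThanSuc_atLeastAtMost del: upt_Suc)
    qed
    have "map (\<lambda>i. K (\<sigma> i)) [1..<Suc n] = map (\<lambda>i. K (\<tau> i)) [1..<Suc n]"
      using list[OF *(1)] list[OF *(2)]
      by (intro sorted_distinct_set_unique) (simp_all only: strict_sorted_iff)
    then have eq: "K (\<sigma> i) = K (\<tau> i)" if "i \<in> {1..n}" for i
      using that by (auto simp del: upt_Suc)
    have perm: "\<sigma> permutes {1..n}" "\<tau> permutes {1..n}" using * by (simp_all add: stable_sort_def)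
    show "\<sigma> = \<tau>"
    proof
      fix i show "\<sigma> i = \<tau> i"
      proof (cases "i \<in> {1..n}")
        case True
        then have "\<sigma> i \<in> {1..n}" "\<tau> i \<in> {1..n}"
          using permutes_in_image[OF perm(1)] permutes_in_image[OF perm(2)] by simp_all
        then show ?thesis using inj_onD[OF inj eq[OF True]] by blast
      qed (use perm in \<open>simp add: permutes_not_in\<close>)
    qed
  qed
qed

abbreviation map_word :: "nat \<Rightarrow> (nat \<Rightarrow> 'a) \<Rightarrow> 'a list" where
  "map_word n f \<equiv> map f [1..<Suc n]"

lemma mset_map_word: "mset (map_word n f) = image_mset f (mset_set {1..n})"
  by (simp add: atLeastLessThanSuc_atLeastAtMost del: upt_Suc)

lemma mset_map_word_permutes:
  assumes "\<sigma> permutes {1..n}"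
  shows "mset (map_word n (\<lambda>i. f (\<sigma> i))) = mset (map_word n f)"
proof -
  have "image_mset \<sigma> (mset_set {1..n}) = mset_set {1..n}"
    using assms by (simp add: image_mset_mset_set permutes_inj_on permutes_image)
  then have "image_mset f (image_mset \<sigma> (mset_set {1..n})) = image_mset f (mset_set {1..n})" by simp
  then show ?thesis by (simp only: mset_map_word multiset.map_comp comp_def)
qed

definition dfun :: "nat multiset \<Rightarrow> nat \<Rightarrow> nat" where
  "dfun b i = dlist b ! (i - 1)"

lemma dfun_antimono: "1 \<le> i \<Longrightarrow> i \<le> j \<Longrightarrow> j \<le> size b \<Longrightarrow> dfun b j \<le> dfun b i"
  unfolding dfun_def by (rule dlist_antimono) auto

lemma map_word_nth: "length v = n \<Longrightarrow> map_word n (\<lambda>k. v ! (k - 1)) = v"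
  by (rule nth_equalityI) (auto simp del: upt_Suc)

lemma map_word_dfun: "map_word (size b) (dfun b) = dlist b"
  unfolding dfun_def by (rule map_word_nth) simp

lemma map_word_dfun_permutes:
  assumes "\<sigma> permutes {1..size b}"
  shows "mset (map_word (size b) (\<lambda>i. dfun b (\<sigma> i))) = b"
  by (simp only: mset_map_word_permutes[OF assms] map_word_dfun mset_dlist)

lemma map_word_eq_iff: "map_word n f = map_word n g \<longleftrightarrow> (\<forall>i\<in>{1..n}. f i = g i)"
  by (auto simp: atLeastLessThanSuc_atLeastAtMost simp del: upt_Suc)

lemma stable_sort_dfun:
  assumes "mset (map_word n v) = b" "\<sigma> permutes {1..n}"
    and "\<And>i. i \<in> {1..<n} \<Longrightarrow> v (\<sigma> (Suc i)) \<le> v (\<sigma> i)" "i \<in> {1..n}"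
  shows "dfun b i = v (\<sigma> i)"
proof -
  have "dlist b = map_word n (\<lambda>i. v (\<sigma> i))"
    using assms(3) by (intro dlist_eqI) (simp_all only: mset_map_word_permutes[OF assms(2)] assms(1), simp del: upt_Suc)
  then show ?thesis using assms(4) by (cases i) (simp_all add: dfun_def del: upt_Suc)
qed

definition descent_compatible :: "(nat \<Rightarrow> nat) \<Rightarrow> nat set \<Rightarrow> bool" where
  "descent_compatible c D \<longleftrightarrow> (\<forall>i\<in>D. c (Suc i) < c i)"

text \<open>\<open>inv \<tau>\<close> lists the positions of the word by weakly decreasing letter.
  Compatibility of its descents says that equal letters are listed from left to right, so
  \<open>inv \<tau>\<close> is the unique stable sort of the word; conversely, a word is sent to the
  inverse of its stable sort.\<close>

lemma bij_betw_standardization: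
  assumes n: "size b = n"
  shows "bij_betw (\<lambda>\<tau>. map_word n (\<lambda>k. dfun b (\<tau> k)))
    {\<tau>. \<tau> permutes {1..n} \<and> descent_compatible (dfun b) (DES n (inv \<tau>))} (permutations_of_multiset b)"
proof -
  let ?T = "{\<tau>. \<tau> permutes {1..n} \<and> descent_compatible (dfun b) (DES n (inv \<tau>))}"
  have stable: "stable_sort n (\<lambda>k. dfun b (\<tau> k)) (inv \<tau>)" if "\<tau> \<in> ?T" for \<tau>
    unfolding stable_sort_def
  proof (intro conjI ballI)
    have \<tau>: "\<tau> permutes {1..n}" using that by simp
    then show "inv \<tau> permutes {1..n}" by (rule permutes_inv)
    fix i assume i: "i \<in> {1..<n}"
    have "inv \<tau> i \<noteq> inv \<tau> (Suc i)" using permutes_inj[OF permutes_inv[OF \<tau>]] by (simp add: inj_eq)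
    then have "dfun b (Suc i) < dfun b i \<or> inv \<tau> i < inv \<tau> (Suc i)"
      using that i by (auto simp: descent_compatible_def DES_def)
    then show "dfun b (\<tau> (inv \<tau> (Suc i))) < dfun b (\<tau> (inv \<tau> i)) \<or>
         dfun b (\<tau> (inv \<tau> (Suc i))) = dfun b (\<tau> (inv \<tau> i)) \<and> inv \<tau> i < inv \<tau> (Suc i)"
      using dfun_antimono[of i "Suc i" b] i n by (auto simp: permutes_inverses[OF \<tau>])
  qed
  show ?thesis
  proof (rule bij_betw_imageI)
    show "inj_on (\<lambda>\<tau>. map_word n (\<lambda>k. dfun b (\<tau> k))) ?T"
    proof (rule inj_onI)
      fix \<tau> \<rho> assume *: "\<tau> \<in> ?T" "\<rho> \<in> ?T"
        and "map_word n (\<lambda>k. dfun b (\<tau> k)) = map_word n (\<lambda>k. dfun b (\<rho> k))"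
      then have eq: "dfun b (\<tau> k) = dfun b (\<rho> k)" if "k \<in> {1..n}" for k
        using that by (simp only: map_word_eq_iff)
      have perm: "inv \<tau> permutes {1..n}" using *(1) permutes_inv by auto
      have "stable_sort n (\<lambda>k. dfun b (\<rho> k)) (inv \<tau>)"
        using stable[OF *(1)] eq permutes_in_image[OF perm] unfolding stable_sort_def by auto
      then have "inv \<tau> = inv \<rho>" using stable[OF *(2)] ex1_stable_sort by blast
      then show "\<tau> = \<rho>" using * by (metis (no_types, lifting) mem_Collect_eq permutes_inv_inv)
    qed
    show "(\<lambda>\<tau>. map_word n (\<lambda>k. dfun b (\<tau> k))) ` ?T = permutations_of_multiset b"
    proof (intro equalityI subsetI)
      fix v assume "v \<in> (\<lambda>\<tau>. map_word n (\<lambda>k. dfun b (\<tau> k))) ` ?T"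
      then show "v \<in> permutations_of_multiset b"
        using map_word_dfun_permutes n by (auto intro: permutations_of_multisetI)
    next
      fix v assume "v \<in> permutations_of_multiset b"
      then have v: "mset v = b" "length v = n" using n by (auto dest: permutations_of_multisetD)
      obtain \<sigma> where \<sigma>: "stable_sort n (\<lambda>k. v ! (k - 1)) \<sigma>" using ex1_stable_sort by blast
      then have perm: "\<sigma> permutes {1..n}" by (simp add: stable_sort_def)
      have dfun: "dfun b i = v ! (\<sigma> i - 1)" if "i \<in> {1..n}" for i
      proof (rule stable_sort_dfun[where v = "\<lambda>k. v ! (k - 1)", OF _ perm _ that])
        show "mset (map_word n (\<lambda>k. v ! (k - 1))) = b" by (simp only: map_word_nth[OF v(2)] v(1))
        show "v ! (\<sigma> (Suc i) - 1) \<le> v ! (\<sigma> i - 1)" if "i \<in> {1..<n}" for i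
        proof -
          have "v ! (\<sigma> (Suc i) - 1) < v ! (\<sigma> i - 1) \<or> v ! (\<sigma> (Suc i) - 1) = v ! (\<sigma> i - 1)"
            using \<sigma> that unfolding stable_sort_def by blast
          then show ?thesis by linarith
        qed
      qed
      have "descent_compatible (dfun b) (DES n \<sigma>)"
        unfolding descent_compatible_def
      proof
        fix i assume "i \<in> DES n \<sigma>"
        then have i: "i \<in> {1..<n}" "\<not> \<sigma> i < \<sigma> (Suc i)" by (auto simp: DES_def)
        then have "v ! (\<sigma> (Suc i) - 1) < v ! (\<sigma> i - 1)" using \<sigma> by (auto simp: stable_sort_def)
        then show "dfun b (Suc i) < dfun b i" using i by (simp add: dfun)
      qed
      then have "inv \<sigma> \<in> ?T" using perm by (simp add: permutes_inv permutes_inv_inv)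
      moreover have "map_word n (\<lambda>k. dfun b (inv \<sigma> k)) = v"
      proof -
        have "map_word n (\<lambda>k. dfun b (inv \<sigma> k)) = map_word n (\<lambda>k. v ! (k - 1))"
        proof (subst map_word_eq_iff, intro ballI)
          fix k assume "k \<in> {1..n}"
          then have "inv \<sigma> k \<in> {1..n}" using permutes_in_image[OF permutes_inv[OF perm]] by blast
          then show "dfun b (inv \<sigma> k) = v ! (k - 1)" by (simp only: dfun permutes_inverses[OF perm])
        qed
        then show ?thesis by (simp only: map_word_nth[OF v(2)])
      qed
      ultimately show "v \<in> (\<lambda>\<tau>. map_word n (\<lambda>k. dfun b (\<tau> k))) ` ?T" by blast
    qed
  qed
qed

text \<open>Covers both ascents (\<open>r\<close> is \<open><\<close>) and descents
  (\<open>r\<close> is \<open>>\<close>), with positions counted from 1 as in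
  \<open>DES\<close>.\<close>

definition breaks :: "('a \<Rightarrow> 'a \<Rightarrow> bool) \<Rightarrow> 'a list \<Rightarrow> nat set" where
  "breaks r v = {i \<in> {1..<length v}. r (v ! (i - 1)) (v ! i)}"

text \<open>Since \<open>dfun b\<close> is weakly decreasing, an ascent of the word forces a descent
  of \<open>\<tau>\<close>. For the converse, ties must be excluded at a descent of
  \<open>\<tau>\<close>.\<close>

lemma breaks_standardization:
  assumes "size b = n" "\<tau> permutes {1..n}" "descent_compatible (dfun b) (DES n (inv \<tau>))"
  shows "breaks (<) (map_word n (\<lambda>k. dfun b (\<tau> k))) = DES n \<tau>"
proof -
  have less: "dfun b y < dfun b x"
    if xy: "x \<in> {1..n}" "y \<in> {1..n}" "x < y" and inv: "inv \<tau> y < inv \<tau> x" for x y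
  proof (rule ccontr)
    assume "\<not> dfun b y < dfun b x"
    with xy assms(1) have eq: "dfun b y = dfun b x" using dfun_antimono[of x y b] by auto
    \<comment> \<open>With equal letters at x and y, \<open>dfun b\<close> is constant between them;
      compatibility then leaves no descent of \<open>inv \<tau>\<close> there.\<close>
    have "inv \<tau> x < inv \<tau> z" if "x < z" "z \<le> y" for z
      using that
    proof (induction z rule: less_induct)
      case (less z)
      then obtain z' where z': "z = Suc z'" by (cases z) auto
      have "dfun b z' \<le> dfun b x" "dfun b y \<le> dfun b z" "dfun b z \<le> dfun b z'"
        using less.prems z' xy assms(1) by (auto intro!: dfun_antimono)
      then have "z' \<notin> DES n (inv \<tau>)" using eq assms(3) z' by (force simp: descent_compatible_def)
      then have "inv \<tau> z' \<le> inv \<tau> z" using less.prems z' xy by (auto simp: DES_def)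
      moreover have "inv \<tau> z' \<noteq> inv \<tau> z"
        using z' permutes_inj[OF permutes_inv[OF assms(2)]] by (simp add: inj_eq)
      ultimately show ?case using less.IH[of z'] less.prems z' by (cases "x = z'") auto
    qed
    from this[of y] inv xy show False by simp
  qed
  have "dfun b (\<tau> i) < dfun b (\<tau> (Suc i)) \<longleftrightarrow> \<tau> (Suc i) < \<tau> i" if i: "i \<in> {1..<n}" for i
  proof -
    have mem: "\<tau> i \<in> {1..n}" "\<tau> (Suc i) \<in> {1..n}"
      using i permutes_in_image[OF assms(2), of i] permutes_in_image[OF assms(2), of "Suc i"] by simp_all
    show ?thesis
    proof (cases "\<tau> (Suc i) < \<tau> i")
      case True
      then show ?thesis
        using less[of "\<tau> (Suc i)" "\<tau> i"] mem by (simp add: permutes_inverses[OF assms(2)])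
    next
      case False
      then show ?thesis using dfun_antimono[of "\<tau> i" "\<tau> (Suc i)" b] mem assms(1) by auto
    qed
  qed
  then show ?thesis by (auto simp: breaks_def DES_def simp del: upt_Suc)
qed

lemma sum_standardization:
  assumes "size b = n"
  shows "(\<Sum>v\<in>permutations_of_multiset b. g (breaks (<) v)) =
    (\<Sum>\<tau> | \<tau> permutes {1..n}. g (DES n \<tau>) * of_bool (descent_compatible (dfun b) (DES n (inv \<tau>))) :: real)"
proof -
  have "(\<Sum>v\<in>permutations_of_multiset b. g (breaks (<) v)) =
      (\<Sum>\<tau> | \<tau> permutes {1..n} \<and> descent_compatible (dfun b) (DES n (inv \<tau>)).
        g (breaks (<) (map_word n (\<lambda>k. dfun b (\<tau> k)))))"
    by (rule sum.reindex_bij_betw[OF bij_betw_standardization[OF assms], symmetric])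
  also have "\<dots> = (\<Sum>\<tau> | \<tau> permutes {1..n} \<and> descent_compatible (dfun b) (DES n (inv \<tau>)). g (DES n \<tau>))"
    using breaks_standardization[OF assms] by (intro sum.cong) auto
  also have "\<dots> = (\<Sum>\<tau> | \<tau> permutes {1..n}. g (DES n \<tau>) * of_bool (descent_compatible (dfun b) (DES n (inv \<tau>))))"
    by (rule sum.mono_neutral_cong_left) (auto simp: finite_permutations)
  finally show ?thesis .
qed

text \<open>Serves both statistics: \<open>D\<close> is the descent set of the inverse in one case
  and \<open>DEX\<close> in the other.\<close>

lemma q_has_sum_descents:
  assumes "0 < q" "q < 1"
  shows "q_has_sum q (\<lambda>b. \<Sum>\<tau>\<in>T. w \<tau> * of_bool (descent_compatible (dfun b) (D \<tau> \<inter> {1..<n}))) n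
    ((\<Sum>\<tau>\<in>T. w \<tau> * q ^ (\<Sum>i\<in>D \<tau> \<inter> {1..<n}. i)) / qpoch q n)"
proof -
  have eq: "descent_compatible (dfun b) E \<longleftrightarrow> (\<forall>i\<in>E. dlist b ! i < dlist b ! (i - 1))" for b E
    by (simp add: descent_compatible_def dfun_def)
  show ?thesis unfolding sum_divide_distrib times_divide_eq_right[symmetric] eq
    using assms by (intro q_has_sum_sum q_has_sum_cmult q_has_sum_chains) auto
qed

lemma DES_subset: "DES n \<sigma> \<inter> {1..<n} = DES n \<sigma>"
  by (auto simp: DES_def)

lemma q_has_sum_breaks:
  assumes "0 < q" "q < 1"
  shows "q_has_sum q (\<lambda>b. \<Sum>v\<in>permutations_of_multiset b. g (breaks (<) v)) n
    ((\<Sum>\<tau> | \<tau> permutes {1..n}. g (DES n \<tau>) * q ^ maj n (inv \<tau>)) / qpoch q n)"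
  using q_has_sum_descents[OF assms, of "\<lambda>\<tau>. g (DES n \<tau>)" "\<lambda>\<tau>. DES n (inv \<tau>)" n "{\<tau>. \<tau> permutes {1..n}}"]
  by (subst q_has_sum_cong[OF sum_standardization]) (simp_all add: DES_subset maj_def del: One_nat_def)

section \<open>Excedances and colored words\<close>

text \<open>The order \<open>1', \<dots>, n', 1, \<dots>, n\<close> on letters, where excedance values are primed,
  following Shareshian and Wachs.\<close>

definition bar_key :: "nat \<Rightarrow> (nat \<Rightarrow> nat) \<Rightarrow> nat \<Rightarrow> nat" where
  "bar_key n \<sigma> i = (if i < \<sigma> i then \<sigma> i else n + \<sigma> i)"

definition DEX :: "nat \<Rightarrow> (nat \<Rightarrow> nat) \<Rightarrow> nat set" where
  "DEX n \<sigma> = {i \<in> {1..<n}. bar_key n \<sigma> (Suc i) < bar_key n \<sigma> i}"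

lemma sum_by_parts_nat:
  fixes x :: "nat \<Rightarrow> int"
  shows "(\<Sum>i\<in>{1..<Suc m}. int i * (x i - x (Suc i))) = (\<Sum>i\<in>{1..m}. x i) - int m * x (Suc m)"
  by (induction m) (simp_all add: algebra_simps)

text \<open>The descent indicators of \<open>\<sigma>\<close> and of its keys differ by x_i -
  x_{i+1}, where x indicates excedances. Weighting by i and summing by parts leaves the sum of all
  x_i, because n is not an excedance.\<close>

lemma maj_eq_DEX_plus_exc:
  assumes \<sigma>: "\<sigma> permutes {1..n}"
  shows "maj n \<sigma> = (\<Sum>i\<in>DEX n \<sigma>. i) + exc n \<sigma>"
proof (cases n)
  case (Suc m)
  define x :: "nat \<Rightarrow> int" where "x i = of_bool (i < \<sigma> i)" for i
  have bounds: "1 \<le> \<sigma> i \<and> \<sigma> i \<le> n" if "i \<in> {1..n}" for i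
    using permutes_in_image[OF \<sigma>, of i] that by simp
  \<comment> \<open>An excedance followed by a non-excedance is a descent of \<open>\<sigma>\<close>
    but not of the keys; in the reverse pattern it is the other way round. Otherwise the two
    comparisons agree.\<close>
  have diff: "of_bool (\<sigma> (Suc i) < \<sigma> i) - of_bool (bar_key n \<sigma> (Suc i) < bar_key n \<sigma> i) = x i - x (Suc i)"
    if "i \<in> {1..<n}" for i
  proof -
    have "\<sigma> i \<noteq> \<sigma> (Suc i)" using permutes_inj[OF \<sigma>] by (simp add: inj_eq)
    then show ?thesis using bounds[of i] bounds[of "Suc i"] that
      by (auto simp: x_def bar_key_def)
  qed
  have "int (maj n \<sigma>) - int (\<Sum>i\<in>DEX n \<sigma>. i) = (\<Sum>i\<in>{1..<n}. int i * of_bool (\<sigma> (Suc i) < \<sigma> i)) -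
      (\<Sum>i\<in>{1..<n}. int i * of_bool (bar_key n \<sigma> (Suc i) < bar_key n \<sigma> i))"
  proof -
    have filter: "(\<Sum>i\<in>{1..<n}. int i * of_bool (P i)) = int (\<Sum>i\<in>{i \<in> {1..<n}. P i}. i)" for P
      unfolding of_nat_sum by (rule sum.mono_neutral_cong_right) auto
    have "{1..n - 1} = {1..<n}" by auto
    then show ?thesis unfolding maj_def DES_def DEX_def filter by simp
  qed
  also have "\<dots> = (\<Sum>i\<in>{1..<n}. int i * (x i - x (Suc i)))"
    unfolding sum_subtractf[symmetric] right_diff_distrib[symmetric]
    by (intro sum.cong refl) (simp only: diff)
  also have "\<dots> = (\<Sum>i\<in>{1..m}. x i)"
    unfolding Suc sum_by_parts_nat using bounds[of n] Suc by (simp add: x_def)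
  also have "\<dots> = int (exc n \<sigma>)"
    unfolding exc_def x_def Suc by (simp add: Int_def conj_commute)
  finally show ?thesis by linarith
qed (simp add: maj_def exc_def DES_def DEX_def)

section \<open>Colored words and their standardization\<close>

definition block_start :: "(nat \<Rightarrow> nat) \<Rightarrow> nat \<Rightarrow> bool" where
  "block_start c k \<longleftrightarrow> k = 1 \<or> c k \<noteq> c (k - 1)"

text \<open>A colored letter is a number \<open>y\<close>, standing for the letter \<open>y div 2\<close>, barred if \<open>y\<close> is odd.\<close>

definition admissible :: "(nat \<Rightarrow> nat) \<Rightarrow> nat \<Rightarrow> nat \<Rightarrow> bool" where
  "admissible c k y \<longleftrightarrow> (if odd y then c k \<le> y div 2 else y div 2 \<le> c k) \<and>
     \<not> (block_start c k \<and> y = 2 * c k + 1)"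

lemma strict_step_growth:
  fixes f :: "nat \<Rightarrow> nat"
  assumes "a \<le> i" "\<And>l. a \<le> l \<Longrightarrow> l < i \<Longrightarrow> f l < f (Suc l)"
  shows "f a + (i - a) \<le> f i"
  using assms
proof (induction i rule: dec_induct)
  case (step i)
  then have "f a + (i - a) \<le> f i" "f i < f (Suc i)" by auto
  with step.hyps show ?case by simp
qed simp

text \<open>Within the block of indices with a given letter j, sorting puts the barred copies first
  and \<open>\<sigma>\<close> increases on each color. Comparing \<open>\<sigma>\<close> with the
  identity at the first or last index of the block, where admissibility bounds it, decides the
  excedance.\<close>

lemma odd_iff_excedance:
  assumes b: "size b = n" and \<sigma>: "stable_sort n v \<sigma>"
    and c: "\<And>i. i \<in> {1..n} \<Longrightarrow> dfun b i = v (\<sigma> i) div 2"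
    and adm: "\<And>k. k \<in> {1..n} \<Longrightarrow> admissible (dfun b) k (v k)"
    and i: "i \<in> {1..n}"
  shows "odd (v (\<sigma> i)) \<longleftrightarrow> i < \<sigma> i"
proof -
  let ?c = "dfun b"
  define j where "j = ?c i"
  have perm: "\<sigma> permutes {1..n}" using \<sigma> by (simp add: stable_sort_def)
  have mem: "\<sigma> l \<in> {1..n}" if "l \<in> {1..n}" for l
    using permutes_in_image[OF perm, of l] that by simp
  have anti: "?c l \<le> ?c k" if "1 \<le> k" "k \<le> l" "l \<le> n" for k l
    using that b by (intro dfun_antimono) auto
  have vi: "v (\<sigma> i) div 2 = j" using c[OF i] by (simp add: j_def)
  have step: "v (\<sigma> (Suc l)) < v (\<sigma> l) \<or> v (\<sigma> (Suc l)) = v (\<sigma> l) \<and> \<sigma> l < \<sigma> (Suc l)" if "l \<in> {1..<n}" for l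
    using \<sigma> that by (simp add: stable_sort_def)
  have desc: "v (\<sigma> l) \<le> v (\<sigma> k)" if "1 \<le> k" "k \<le> l" "l \<le> n" for k l
    using stable_sortD[OF \<sigma>, of k l] that by (cases "k = l") auto
  define P where "P = {l \<in> {1..n}. ?c l = j}"
  have P: "finite P" "i \<in> P" using i by (auto simp: P_def j_def)
  show ?thesis
  proof
    assume odd: "odd (v (\<sigma> i))"
    show "i < \<sigma> i"
    proof (rule ccontr)
      assume "\<not> i < \<sigma> i"
      then have le: "\<sigma> i \<le> i" by simp
      \<comment> \<open>All indices from the block start \<open>a\<close> to \<open>i\<close> carry
        the barred letter 2j + 1. Admissibility gives \<open>a \<le> \<sigma> a\<close>, and growth
        along the block then leaves only \<open>\<sigma> a = a\<close>, where a barred j is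
        forbidden.\<close>
      define a where "a = Min P"
      have a: "a \<in> P" "a \<le> i" unfolding a_def using P by (auto intro: Min_in)
      then have a': "1 \<le> a" "a \<le> n" "?c a = j" by (auto simp: P_def)
      have start: "block_start ?c a"
      proof -
        have "a - 1 \<notin> P" if "a \<noteq> 1" using Min_le[OF P(1), of "a - 1"] a' that a_def by auto
        then show ?thesis using a' by (auto simp: block_start_def P_def)
      qed
      have block: "?c l = j" if "a \<le> l" "l \<le> i" for l
        using anti[of a l] anti[of l i] that a' i by (auto simp: j_def)
      have val: "v (\<sigma> l) = 2 * j + 1" if "a \<le> l" "l \<le> i" for l
      proof -
        have "v (\<sigma> i) \<le> v (\<sigma> l)" using desc[of l i] that a' i by auto
        moreover have "v (\<sigma> l) div 2 = j" using c[of l] block[OF that] that a' i by auto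
        ultimately show ?thesis using odd vi by presburger
      qed
      have "\<sigma> l < \<sigma> (Suc l)" if "a \<le> l" "l < i" for l
        using step[of l] val[of l] val[of "Suc l"] that a' i by auto
      then have "\<sigma> a + (i - a) \<le> \<sigma> i" using a by (intro strict_step_growth) auto
      moreover have "a \<le> \<sigma> a"
      proof (rule ccontr)
        assume "\<not> a \<le> \<sigma> a"
        moreover have "1 \<le> \<sigma> a" "\<sigma> a \<le> n" using mem[of a] a' by auto
        ultimately have "j \<le> ?c (\<sigma> a)" "\<sigma> a \<notin> P"
          using anti[of "\<sigma> a" a] a' Min_le[OF P(1), of "\<sigma> a"] by (auto simp: a_def)
        then have "j < ?c (\<sigma> a)" using \<open>1 \<le> \<sigma> a\<close> \<open>\<sigma> a \<le> n\<close> by (auto simp: P_def)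
        then show False using adm[of "\<sigma> a"] val[of a] a mem[of a] a' by (auto simp: admissible_def)
      qed
      ultimately have "\<sigma> a = a" using le a by linarith
      then show False using adm[of a] val[of a] a a' start by (auto simp: admissible_def)
    qed
  next
    assume gt: "i < \<sigma> i"
    show "odd (v (\<sigma> i))"
    proof (rule ccontr)
      assume even: "\<not> odd (v (\<sigma> i))"
      \<comment> \<open>Dually, all indices from \<open>i\<close> to the block end \<open>e\<close>
        carry the unbarred letter 2j, and admissibility gives
        \<open>\<sigma> e \<le> e\<close>.\<close>
      define e where "e = Max P"
      have e: "e \<in> P" "i \<le> e" unfolding e_def using P by (auto intro: Max_in)
      then have e': "1 \<le> e" "e \<le> n" "?c e = j" by (auto simp: P_def)
      have block: "?c l = j" if "i \<le> l" "l \<le> e" for l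
        using anti[of i l] anti[of l e] that e' i by (auto simp: j_def)
      have val: "v (\<sigma> l) = 2 * j" if "i \<le> l" "l \<le> e" for l
      proof -
        have "v (\<sigma> l) \<le> v (\<sigma> i)" using desc[of i l] that e' i by auto
        moreover have "v (\<sigma> l) div 2 = j" using c[of l] block[OF that] that e' i by auto
        ultimately show ?thesis using even vi by presburger
      qed
      have "\<sigma> l < \<sigma> (Suc l)" if "i \<le> l" "l < e" for l
        using step[of l] val[of l] val[of "Suc l"] that e' i by auto
      then have "\<sigma> i + (e - i) \<le> \<sigma> e" using e by (intro strict_step_growth) auto
      moreover have "\<sigma> e \<le> e"
      proof (rule ccontr)
        assume "\<not> \<sigma> e \<le> e"
        moreover have "1 \<le> \<sigma> e" "\<sigma> e \<le> n" using mem[of e] e' by auto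
        ultimately have "?c (\<sigma> e) \<le> j" "\<sigma> e \<notin> P"
          using anti[of e "\<sigma> e"] e' Max_ge[OF P(1), of "\<sigma> e"] by (auto simp: e_def)
        then have "?c (\<sigma> e) < j" using \<open>1 \<le> \<sigma> e\<close> \<open>\<sigma> e \<le> n\<close> by (auto simp: P_def)
        then show False using adm[of "\<sigma> e"] val[of e] e mem[of e] e' by (auto simp: admissible_def)
      qed
      ultimately show False using gt e by linarith
    qed
  qed
qed

definition colored_words :: "nat \<Rightarrow> nat multiset \<Rightarrow> nat list set" where
  "colored_words n b = {v. length v = n \<and> mset (map (\<lambda>y. y div 2) v) = b}"

text \<open>A permutation becomes the word whose letter at position \<open>k\<close> is that of
  \<open>inv \<sigma> k\<close>, barred if \<open>k\<close> is an excedance value. The order of the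
  keys agrees with that of the colored letters, so \<open>\<sigma>\<close> is recovered as the
  stable sort.\<close>

lemma bij_betw_colored_standardization:
  assumes b: "size b = n"
  shows "bij_betw (\<lambda>\<sigma>. map_word n (\<lambda>k. 2 * dfun b (inv \<sigma> k) + of_bool (inv \<sigma> k < k)))
    {\<sigma>. \<sigma> permutes {1..n} \<and> descent_compatible (dfun b) (DEX n \<sigma>)}
    {v \<in> colored_words n b. \<forall>k\<in>{1..n}. admissible (dfun b) k (v ! (k - 1))}"
    (is "bij_betw ?f ?S ?W")
proof (rule bij_betw_imageI)
  let ?c = "dfun b"
  define u where "u \<sigma> k = 2 * ?c (inv \<sigma> k) + of_bool (inv \<sigma> k < k)" for \<sigma> k
  have anti: "?c l \<le> ?c k" if "1 \<le> k" "k \<le> l" "l \<le> n" for k l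
    using that b by (intro dfun_antimono) auto
  have u\<sigma>: "u \<sigma> (\<sigma> i) = 2 * ?c i + of_bool (i < \<sigma> i)" if "\<sigma> permutes {1..n}" for \<sigma> i
    using that by (simp add: u_def permutes_inverses)
  have stable: "stable_sort n (u \<sigma>) \<sigma>" if "\<sigma> \<in> ?S" for \<sigma>
    unfolding stable_sort_def
  proof (intro conjI ballI)
    show perm: "\<sigma> permutes {1..n}" using that by simp
    fix i assume i: "i \<in> {1..<n}"
    have "\<sigma> i \<noteq> \<sigma> (Suc i)" using permutes_inj[OF perm] by (simp add: inj_eq)
    moreover have "1 \<le> \<sigma> i" "\<sigma> (Suc i) \<le> n"
      using permutes_in_image[OF perm, of i] permutes_in_image[OF perm, of "Suc i"] i by auto
    moreover have "?c (Suc i) \<le> ?c i" using i by (intro anti) auto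
    moreover have "?c (Suc i) < ?c i \<or> bar_key n \<sigma> i \<le> bar_key n \<sigma> (Suc i)"
      using that i by (auto simp: descent_compatible_def DEX_def not_less)
    ultimately show "u \<sigma> (\<sigma> (Suc i)) < u \<sigma> (\<sigma> i) \<or>
        u \<sigma> (\<sigma> (Suc i)) = u \<sigma> (\<sigma> i) \<and> \<sigma> i < \<sigma> (Suc i)"
      unfolding u\<sigma>[OF perm] bar_key_def by (auto split: if_splits)
  qed
  show "inj_on ?f ?S"
  proof (rule inj_onI)
    fix \<sigma> \<rho> assume *: "\<sigma> \<in> ?S" "\<rho> \<in> ?S" and "?f \<sigma> = ?f \<rho>"
    then have eq: "u \<sigma> k = u \<rho> k" if "k \<in> {1..n}" for k
      using that by (simp only: map_word_eq_iff u_def)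
    have "\<sigma> permutes {1..n}" using *(1) by auto
    then have "stable_sort n (u \<rho>) \<sigma>"
      using stable[OF *(1)] eq permutes_in_image[OF \<open>\<sigma> permutes {1..n}\<close>] unfolding stable_sort_def by auto
    then show "\<sigma> = \<rho>" using stable[OF *(2)] ex1_stable_sort by blast
  qed
  show "?f ` ?S = ?W"
  proof (intro equalityI subsetI)
    fix v assume "v \<in> ?f ` ?S"
    then obtain \<sigma> where \<sigma>: "\<sigma> \<in> ?S" "v = map_word n (u \<sigma>)" by (auto simp: u_def)
    then have perm: "\<sigma> permutes {1..n}" by simp
    have "map (\<lambda>y. y div 2) v = map_word n (\<lambda>i. ?c (inv \<sigma> i))"
      by (simp add: \<sigma>(2) u_def del: upt_Suc)
    moreover have "mset (map_word n (\<lambda>i. ?c (inv \<sigma> i))) = b"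
      using map_word_dfun_permutes[of "inv \<sigma>" b] permutes_inv[OF perm] b by (simp only:)
    moreover have "length v = n" by (simp add: \<sigma>(2) del: upt_Suc)
    ultimately have "v \<in> colored_words n b" by (simp only: colored_words_def mem_Collect_eq)
    moreover have "admissible ?c k (u \<sigma> k)" if k: "k \<in> {1..n}" for k
    proof -
      have i: "inv \<sigma> k \<in> {1..n}" using permutes_in_image[OF permutes_inv[OF perm], of k] k by blast
      \<comment> \<open>A barred letter equal to that of \<open>k\<close> comes from an earlier
        index, so the block already contains k - 1.\<close>
      have "\<not> block_start ?c k" if lt: "inv \<sigma> k < k" and eq: "?c (inv \<sigma> k) = ?c k"
        using anti[of "inv \<sigma> k" "k - 1"] anti[of "k - 1" k] i k lt eq by (simp add: block_start_def) linarith
      moreover have "odd (u \<sigma> k) \<longleftrightarrow> inv \<sigma> k < k" "u \<sigma> k div 2 = ?c (inv \<sigma> k)"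
        by (auto simp: u_def)
      moreover have "inv \<sigma> k < k \<Longrightarrow> ?c k \<le> ?c (inv \<sigma> k)" "\<not> inv \<sigma> k < k \<Longrightarrow> ?c (inv \<sigma> k) \<le> ?c k"
        using anti[of "inv \<sigma> k" k] anti[of k "inv \<sigma> k"] i k by auto
      ultimately show ?thesis unfolding admissible_def by force
    qed
    ultimately show "v \<in> ?W" by (auto simp: \<sigma>(2) simp del: upt_Suc)
  next
    fix v assume v: "v \<in> ?W"
    then have len: "length v = n" and mset: "mset (map (\<lambda>y. y div 2) v) = b"
      by (auto simp: colored_words_def)
    define vf where "vf k = v ! (k - 1)" for k
    have adm: "admissible ?c k (vf k)" if "k \<in> {1..n}" for k using v that by (simp add: vf_def)
    obtain \<sigma> where \<sigma>: "stable_sort n vf \<sigma>" using ex1_stable_sort by blast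
    then have perm: "\<sigma> permutes {1..n}" by (simp add: stable_sort_def)
    have step: "vf (\<sigma> (Suc l)) < vf (\<sigma> l) \<or> vf (\<sigma> (Suc l)) = vf (\<sigma> l) \<and> \<sigma> l < \<sigma> (Suc l)" if "l \<in> {1..<n}" for l
      using \<sigma> that by (simp add: stable_sort_def)
    have c: "?c i = vf (\<sigma> i) div 2" if "i \<in> {1..n}" for i
    proof (rule stable_sort_dfun[where v = "\<lambda>k. vf k div 2", OF _ perm _ that])
      have "map_word n vf = v" unfolding vf_def by (rule map_word_nth[OF len])
      then have "map_word n (\<lambda>k. vf k div 2) = map (\<lambda>y. y div 2) v" by (auto simp del: upt_Suc)
      then show "mset (map_word n (\<lambda>k. vf k div 2)) = b" using mset by simp
      show "vf (\<sigma> (Suc l)) div 2 \<le> vf (\<sigma> l) div 2" if "l \<in> {1..<n}" for l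
        using step[OF that] by (intro div_le_mono) linarith
    qed
    have odd: "odd (vf (\<sigma> i)) \<longleftrightarrow> i < \<sigma> i" if "i \<in> {1..n}" for i
      by (rule odd_iff_excedance[OF b \<sigma> c adm that])
    have val: "vf (\<sigma> i) = 2 * ?c i + of_bool (i < \<sigma> i)" if "i \<in> {1..n}" for i
      using c[OF that] odd[OF that] by (cases "i < \<sigma> i") auto
    have "descent_compatible ?c (DEX n \<sigma>)"
      unfolding descent_compatible_def
    proof
      fix i assume "i \<in> DEX n \<sigma>"
      then have i: "i \<in> {1..<n}" "bar_key n \<sigma> (Suc i) < bar_key n \<sigma> i" by (auto simp: DEX_def)
      have "1 \<le> \<sigma> (Suc i)" "\<sigma> i \<le> n"
        using permutes_in_image[OF perm, of i] permutes_in_image[OF perm, of "Suc i"] i by auto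
      moreover have "?c (Suc i) \<le> ?c i" using i by (intro anti) auto
      ultimately show "?c (Suc i) < ?c i"
        using step[OF i(1)] i val[of i] val[of "Suc i"] unfolding bar_key_def by (auto split: if_splits)
    qed
    then have "\<sigma> \<in> ?S" using perm by simp
    moreover have "?f \<sigma> = v"
    proof -
      have "map_word n (\<lambda>k. 2 * ?c (inv \<sigma> k) + of_bool (inv \<sigma> k < k)) = map_word n vf"
      proof (subst map_word_eq_iff, intro ballI)
        fix k assume "k \<in> {1..n}"
        then have "inv \<sigma> k \<in> {1..n}" using permutes_in_image[OF permutes_inv[OF perm]] by blast
        from val[OF this] show "2 * ?c (inv \<sigma> k) + of_bool (inv \<sigma> k < k) = vf k"
          by (simp only: permutes_inverses[OF perm])
      qed
      also have "map_word n vf = v" unfolding vf_def by (rule map_word_nth[OF len])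
      finally show ?thesis .
    qed
    ultimately show "v \<in> ?f ` ?S" by blast
  qed
qed

lemma finite_colored_words: "finite (colored_words n b)"
proof (rule finite_subset)
  show "colored_words n b \<subseteq> {v. set v \<subseteq> (\<Union>y\<in>set_mset b. {2 * y, 2 * y + 1}) \<and> length v = n}"
  proof
    fix v assume v: "v \<in> colored_words n b"
    have "x \<in> (\<Union>y\<in>set_mset b. {2 * y, 2 * y + 1})" if "x \<in> set v" for x
    proof -
      have "x div 2 \<in># b" using v that by (auto simp: colored_words_def)
      moreover have "x = 2 * (x div 2) \<or> x = 2 * (x div 2) + 1" by presburger
      ultimately show ?thesis by blast
    qed
    then show "v \<in> {v. set v \<subseteq> (\<Union>y\<in>set_mset b. {2 * y, 2 * y + 1}) \<and> length v = n}"
      using v by (auto simp: colored_words_def)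
  qed
qed (simp add: finite_lists_length_eq)

text \<open>The weights of the positions are independent, so the two colors of each letter can be
  summed first.\<close>

lemma sum_colored_words:
  "(\<Sum>v\<in>colored_words (length us) b. \<Prod>k<length us. (us ! k) (v ! k)) =
    word_sum (map (\<lambda>u y. u (2 * y) + u (2 * y + 1)) us) b"
proof (induction us arbitrary: b)
  case Nil
  have "colored_words 0 b = (if b = {#} then {[]} else {})" by (auto simp: colored_words_def)
  then show ?case by simp
next
  case (Cons u us)
  let ?n = "length us"
  have "(\<Sum>v\<in>colored_words (Suc ?n) b. \<Prod>k<Suc ?n. ((u # us) ! k) (v ! k)) =
      (\<Sum>(x, v)\<in>(SIGMA x:(\<Union>y\<in>set_mset b. {2 * y, 2 * y + 1}). colored_words ?n (b - {#x div 2#})).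
        u x * (\<Prod>k<?n. (us ! k) (v ! k)))"
  proof (rule sum.reindex_bij_witness[where i = "\<lambda>(x, v). x # v" and j = "\<lambda>v. (hd v, tl v)"])
    fix v assume v: "v \<in> colored_words (Suc ?n) b"
    then obtain x w where xw: "v = x # w" by (cases v) (auto simp: colored_words_def)
    have "x div 2 \<in># b" using v xw by (auto simp: colored_words_def)
    moreover have "x = 2 * (x div 2) \<or> x = 2 * (x div 2) + 1" by presburger
    ultimately have "x \<in> (\<Union>y\<in>set_mset b. {2 * y, 2 * y + 1})" by blast
    then show "(hd v, tl v) \<in> (SIGMA x:(\<Union>y\<in>set_mset b. {2 * y, 2 * y + 1}). colored_words ?n (b - {#x div 2#}))"
      using v xw by (auto simp: colored_words_def)
    show "(case (hd v, tl v) of (x, v) \<Rightarrow> x # v) = v" by (simp add: xw)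
    show "(case (hd v, tl v) of (x, v) \<Rightarrow> u x * (\<Prod>k<?n. (us ! k) (v ! k))) =
        (\<Prod>k<Suc ?n. ((u # us) ! k) (v ! k))"
      by (simp add: xw prod.lessThan_Suc_shift del: prod.lessThan_Suc)
  qed (auto simp: colored_words_def)
  also have "\<dots> = (\<Sum>x\<in>(\<Union>y\<in>set_mset b. {2 * y, 2 * y + 1}).
      u x * (\<Sum>v\<in>colored_words ?n (b - {#x div 2#}). \<Prod>k<?n. (us ! k) (v ! k)))"
    by (subst sum.Sigma[symmetric]) (auto simp: finite_colored_words sum_distrib_left)
  also have "\<dots> = (\<Sum>y\<in>set_mset b. \<Sum>x\<in>{2 * y, 2 * y + 1}.
      u x * (\<Sum>v\<in>colored_words ?n (b - {#x div 2#}). \<Prod>k<?n. (us ! k) (v ! k)))"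
    by (rule sum.UNION_disjoint) auto
  also have "\<dots> = word_sum (map (\<lambda>u y. u (2 * y) + u (2 * y + 1)) (u # us)) b"
    by (simp add: Cons.IH distrib_right)
  finally show ?case by simp
qed

text \<open>Block starts correspond one to one to the distinct letters of \<open>b\<close>; the
  other positions carry the remaining copies.\<close>

lemma N_coeff_positions:
  assumes b: "size b = n"
  shows "word_sum (map_word n (\<lambda>k. if block_start (dfun b) k then A_weight t (dfun b k) else L_weight t (dfun b k))) b
    = N_coeff t b"
proof -
  let ?c = "dfun b"
  define F where "F = {k \<in> {1..n}. block_start ?c k}"
  define G where "G = {k \<in> {1..n}. \<not> block_start ?c k}"
  have anti: "?c l \<le> ?c k" if "1 \<le> k" "k \<le> l" "l \<le> n" for k l
    using that b by (intro dfun_antimono) auto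
  have FG: "mset_set {1..n} = mset_set F + mset_set G"
    by (subst mset_set_Union[symmetric]) (auto simp: F_def G_def intro: arg_cong[of _ _ mset_set])
  have "mset (map_word n ?c) = b" by (metis b map_word_dfun mset_dlist)
  then have image: "image_mset ?c (mset_set {1..n}) = b" by (simp only: mset_map_word)
  have inj: "inj_on ?c F"
  proof (rule linorder_inj_onI)
    fix k l assume kl: "k < l" "k \<in> F" "l \<in> F"
    then have "?c l \<le> ?c (l - 1)" "?c (l - 1) \<le> ?c k" "?c l \<noteq> ?c (l - 1)"
      by (auto intro!: anti simp: F_def block_start_def)
    then show "?c k \<noteq> ?c l" by linarith
  qed auto
  have "?c ` F = set_mset b"
  proof (intro equalityI subsetI)
    fix y assume "y \<in> ?c ` F"
    then show "y \<in> set_mset b" by (subst image[symmetric]) (auto simp: F_def)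
  next
    fix y assume "y \<in> set_mset b"
    then have ex: "\<exists>k. k \<in> {1..n} \<and> ?c k = y" by (subst (asm) image[symmetric]) auto
    \<comment> \<open>The first position of a letter starts its block.\<close>
    define k where "k = (LEAST k. k \<in> {1..n} \<and> ?c k = y)"
    have k: "k \<in> {1..n}" "?c k = y" using LeastI_ex[OF ex] by (simp_all add: k_def)
    have "\<not> (k - 1 \<in> {1..n} \<and> ?c (k - 1) = y)"
      using k not_less_Least[of "k - 1" "\<lambda>k. k \<in> {1..n} \<and> ?c k = y", folded k_def] by simp
    then have "block_start ?c k" using k by (auto simp: block_start_def)
    then show "y \<in> ?c ` F" using k by (auto simp: F_def)
  qed
  then have F: "image_mset ?c (mset_set F) = mset_set (set_mset b)"
    using inj by (simp add: image_mset_mset_set)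
  then have G: "image_mset ?c (mset_set G) = b - mset_set (set_mset b)"
    using image unfolding FG by (metis add_diff_cancel_left' image_mset_union)
  have "mset (map_word n (\<lambda>k. if block_start ?c k then A_weight t (?c k) else L_weight t (?c k))) =
      image_mset (A_weight t) (image_mset ?c (mset_set F)) + image_mset (L_weight t) (image_mset ?c (mset_set G))"
    unfolding mset_map_word FG image_mset_union multiset.map_comp comp_def
    by (intro arg_cong2[of _ _ _ _ "(+)"] image_mset_cong) (auto simp: F_def G_def)
  also have "\<dots> = mset (map (A_weight t) (rev (sorted_list_of_set (set_mset b))) @
      map (L_weight t) (dlist (b - mset_set (set_mset b))))"
  proof -
    have "mset (sorted_list_of_set (set_mset b)) = mset_set (set_mset b)"
      by (metis finite_set_mset mset_sorted_list_of_multiset sorted_list_of_mset_set)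
    then show ?thesis by (simp add: F G)
  qed
  finally show ?thesis unfolding N_coeff_def by (rule word_sum_perm)
qed

text \<open>Excedances are the barred letters of the colored word. Admissibility constrains each
  position separately, so the sum is a coefficient in a product of linear forms, one for each
  position.\<close>

lemma sum_exc_eq_N_coeff:
  assumes b: "size b = n"
  shows "(\<Sum>\<sigma> | \<sigma> permutes {1..n}. t ^ exc n \<sigma> * of_bool (descent_compatible (dfun b) (DEX n \<sigma>))) = N_coeff t b"
proof -
  let ?S = "{\<sigma>. \<sigma> permutes {1..n} \<and> descent_compatible (dfun b) (DEX n \<sigma>)}"
  let ?W = "{v \<in> colored_words n b. \<forall>k\<in>{1..n}. admissible (dfun b) k (v ! (k - 1))}"
  let ?f = "\<lambda>\<sigma>. map_word n (\<lambda>k. 2 * dfun b (inv \<sigma> k) + of_bool (inv \<sigma> k < k))"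
  \<comment> \<open>Weight of the colored letter y at position k, zero if not admissible. Adding
    both colors gives \<open>A_weight\<close> at a block start and \<open>L_weight\<close>
    elsewhere.\<close>
  define u where "u k y = of_bool (admissible (dfun b) k y) * t ^ of_bool (odd y)" for k y
  have pos: "(\<Prod>k<n. h (Suc k)) = (\<Prod>k\<in>{1..n}. h k)" for h :: "nat \<Rightarrow> real"
    using prod.atLeast1_atMost_eq[of h n] by simp
  have "(\<Sum>\<sigma> | \<sigma> permutes {1..n}. t ^ exc n \<sigma> * of_bool (descent_compatible (dfun b) (DEX n \<sigma>))) =
      (\<Sum>\<sigma>\<in>?S. t ^ exc n \<sigma>)"
    by (rule sum.mono_neutral_cong_right) (auto simp: finite_permutations)
  also have "\<dots> = (\<Sum>\<sigma>\<in>?S. \<Prod>k\<in>{1..n}. t ^ of_bool (odd (?f \<sigma> ! (k - 1))))"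
  proof (intro sum.cong refl)
    fix \<sigma> assume "\<sigma> \<in> ?S"
    then have perm: "\<sigma> permutes {1..n}" by simp
    have "(\<Prod>k\<in>{1..n}. t ^ of_bool (odd (?f \<sigma> ! (k - 1)))) = (\<Prod>k\<in>{1..n}. t ^ of_bool (inv \<sigma> k < k))"
      by (intro prod.cong refl) (auto simp del: upt_Suc)
    also have "\<dots> = (\<Prod>i\<in>{1..n}. t ^ of_bool (i < \<sigma> i))"
      using prod.permute[OF perm, of "\<lambda>k. t ^ of_bool (inv \<sigma> k < k)"]
      by (simp add: comp_def permutes_inverses[OF perm])
    also have "\<dots> = t ^ (\<Sum>i\<in>{1..n}. of_bool (i < \<sigma> i))" by (simp only: power_sum)
    also have "(\<Sum>i\<in>{1..n}. of_bool (i < \<sigma> i)) = exc n \<sigma>"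
    proof -
      have "\<sigma> n \<le> n" using permutes_in_image[OF perm, of n] permutes_not_in[OF perm, of n] by (cases "n \<in> {1..n}") auto
      then have "{i \<in> {1..n}. i < \<sigma> i} = {i \<in> {1..n - 1}. i < \<sigma> i}"
        by (auto simp: order.strict_iff_order) (metis Suc_pred le_SucE le_less_trans less_le_not_le not_less_eq_eq zero_less_Suc)
      then show ?thesis by (simp add: exc_def of_bool_def sum.inter_filter[symmetric])
    qed
    finally show "t ^ exc n \<sigma> = (\<Prod>k\<in>{1..n}. t ^ of_bool (odd (?f \<sigma> ! (k - 1))))" ..
  qed
  also have "\<dots> = (\<Sum>v\<in>?W. \<Prod>k\<in>{1..n}. t ^ of_bool (odd (v ! (k - 1))))"
    by (rule sum.reindex_bij_betw[OF bij_betw_colored_standardization[OF b]])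
  also have "\<dots> = (\<Sum>v\<in>colored_words n b. \<Prod>k\<in>{1..n}. u k (v ! (k - 1)))"
  proof (rule sum.mono_neutral_cong_left)
    show "\<forall>v\<in>colored_words n b - ?W. (\<Prod>k\<in>{1..n}. u k (v ! (k - 1))) = 0"
    proof
      fix v assume "v \<in> colored_words n b - ?W"
      then obtain k where "k \<in> {1..n}" "\<not> admissible (dfun b) k (v ! (k - 1))" by auto
      then show "(\<Prod>k\<in>{1..n}. u k (v ! (k - 1))) = 0"
        by (intro prod_zero bexI[of _ k]) (auto simp: u_def)
    qed
  qed (auto simp: finite_colored_words u_def intro!: prod.cong)
  also have "\<dots> = (\<Sum>v\<in>colored_words n b. \<Prod>k<n. (map_word n u ! k) (v ! k))"
  proof (intro sum.cong refl)
    fix v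
    have "(\<Prod>k<n. (map_word n u ! k) (v ! k)) = (\<Prod>k<n. u (Suc k) (v ! (Suc k - 1)))"
      by (intro prod.cong refl) (auto simp del: upt_Suc)
    then show "(\<Prod>k\<in>{1..n}. u k (v ! (k - 1))) = (\<Prod>k<n. (map_word n u ! k) (v ! k))"
      using pos[of "\<lambda>k. u k (v ! (k - 1))"] by simp
  qed
  also have "\<dots> = word_sum (map (\<lambda>u y. u (2 * y) + u (2 * y + 1)) (map_word n u)) b"
    using sum_colored_words[of "map_word n u" b] by (simp del: upt_Suc)
  also have "map (\<lambda>u y. u (2 * y) + u (2 * y + 1)) (map_word n u) =
      map_word n (\<lambda>k. if block_start (dfun b) k then A_weight t (dfun b k) else L_weight t (dfun b k))"
    unfolding map_map comp_def
    by (intro map_cong refl ext) (auto simp: u_def admissible_def A_weight_def L_weight_def)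
  also have "word_sum \<dots> b = N_coeff t b" by (rule N_coeff_positions[OF b])
  finally show ?thesis .
qed

lemma q_has_sum_N_coeff:
  assumes "0 < q" "q < 1"
  shows "q_has_sum q (N_coeff t) n ((\<Sum>\<sigma> | \<sigma> permutes {1..n}. t ^ exc n \<sigma> * q ^ (maj n \<sigma> - exc n \<sigma>)) / qpoch q n)"
proof -
  have D: "DEX n \<sigma> \<inter> {1..<n} = DEX n \<sigma>" for \<sigma> by (auto simp: DEX_def)
  have maj: "(\<Sum>i\<in>DEX n \<sigma>. i) = maj n \<sigma> - exc n \<sigma>" if "\<sigma> permutes {1..n}" for \<sigma>
    using maj_eq_DEX_plus_exc[OF that] by simp
  have "q_has_sum q (\<lambda>b. \<Sum>\<sigma> | \<sigma> permutes {1..n}. t ^ exc n \<sigma> * of_bool (descent_compatible (dfun b) (DEX n \<sigma>))) n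
     ((\<Sum>\<sigma> | \<sigma> permutes {1..n}. t ^ exc n \<sigma> * q ^ (\<Sum>i\<in>DEX n \<sigma>. i)) / qpoch q n)"
    using q_has_sum_descents[OF assms, of "\<lambda>\<sigma>. t ^ exc n \<sigma>" "DEX n" n "{\<sigma>. \<sigma> permutes {1..n}}"] by (simp only: D)
  moreover have "(\<Sum>\<sigma> | \<sigma> permutes {1..n}. t ^ exc n \<sigma> * q ^ (\<Sum>i\<in>DEX n \<sigma>. i)) =
      (\<Sum>\<sigma> | \<sigma> permutes {1..n}. t ^ exc n \<sigma> * q ^ (maj n \<sigma> - exc n \<sigma>))"
    by (intro sum.cong refl) (simp add: maj)
  ultimately show ?thesis by (subst (asm) q_has_sum_cong[OF sum_exc_eq_N_coeff]) simp_all
qed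

section \<open>Inversions and the major index of the inverse\<close>

lemma breaks_Nil [simp]: "breaks r [] = {}"
  by (simp add: breaks_def)

lemma breaks_Cons: "breaks r (x # v) = (if v \<noteq> [] \<and> r x (hd v) then {1} else {}) \<union> Suc ` breaks r v"
proof (rule set_eqI)
  fix i
  show "i \<in> breaks r (x # v) \<longleftrightarrow> i \<in> (if v \<noteq> [] \<and> r x (hd v) then {1} else {}) \<union> Suc ` breaks r v"
  proof (cases i)
    case (Suc j)
    then show ?thesis by (cases j) (auto simp: breaks_def hd_conv_nth nth_Cons')
  qed (auto simp: breaks_def)
qed

lemma finite_breaks [simp]: "finite (breaks r v)"
  by (simp add: breaks_def)

lemma breaks_take: "m \<le> length v \<Longrightarrow> breaks r (take m v) = breaks r v \<inter> {1..<m}"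
  by (auto simp: breaks_def)

lemma breaks_drop: "m \<le> length v \<Longrightarrow> breaks r (drop m v) = {i. 1 \<le> i \<and> m + i \<in> breaks r v}"
  by (auto simp: breaks_def nth_drop)

definition shift_down :: "nat \<Rightarrow> nat set \<Rightarrow> nat set" where
  "shift_down m D = {i. 1 \<le> i \<and> m + i \<in> D}"

text \<open>Cutting after m letters forgets only whether there is a break at m. No breaks before m
  and the shifted ones behind it leave exactly the two cases \<open>D\<close> and
  \<open>D - {m}\<close>.\<close>

lemma of_bool_breaks_split:
  assumes "D \<subseteq> {1..<length v}" "D \<noteq> {}" and m: "m = Min D"
  shows "of_bool (breaks r v = D) + of_bool (breaks r v = D - {m}) =
    (of_bool (breaks r (take m v) = {}) * of_bool (breaks r (drop m v) = shift_down m D) :: real)"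
proof -
  have fin: "finite D" using assms(1) finite_subset by blast
  have D: "m \<in> D" "\<And>i. i \<in> D \<Longrightarrow> m \<le> i" using fin assms(2) by (auto simp: m)
  then have len: "m \<le> length v" and pos: "1 \<le> m" using assms(1) by (auto dest: subsetD)
  have "breaks r v = D \<or> breaks r v = D - {m} \<longleftrightarrow>
      breaks r (take m v) = {} \<and> breaks r (drop m v) = shift_down m D"
    (is "?L \<longleftrightarrow> ?R")
  proof
    assume ?L
    then show ?R
      unfolding breaks_take[OF len] breaks_drop[OF len] shift_down_def using D(2) by fastforce
  next
    assume ?R
    then have R: "breaks r v \<inter> {1..<m} = {}" "\<And>i. 1 \<le> i \<Longrightarrow> m + i \<in> breaks r v \<longleftrightarrow> m + i \<in> D"
      unfolding breaks_take[OF len] breaks_drop[OF len] shift_down_def by auto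
    have "i \<in> breaks r v \<longleftrightarrow> i \<in> D" if "i \<noteq> m" for i
    proof (cases "i < m")
      case True
      moreover have "i \<notin> breaks r v" using R(1) True by (auto simp: breaks_def)
      ultimately show ?thesis using D(2)[of i] by auto
    next
      case False
      then show ?thesis using R(2)[of "i - m"] that by auto
    qed
    then have eq: "breaks r v - {m} = D - {m}" by blast
    show ?L
    proof (cases "m \<in> breaks r v")
      case True
      then have "breaks r v = D" using eq D(1) by (metis insert_Diff)
      then show ?thesis ..
    next
      case False
      then show ?thesis using eq by simp
    qed
  qed
  moreover have "D \<noteq> D - {m}" using D(1) by auto
  ultimately show ?thesis by (auto simp: of_bool_def)
qed

lemma breaks_less_empty_iff: "breaks (<) u = {} \<longleftrightarrow> dlist (mset u) = u"
proof
  assume *: "breaks (<) u = {}"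
  show "dlist (mset u) = u"
  proof (rule dlist_eqI)
    fix i assume "Suc i < length u"
    moreover have "Suc i \<notin> breaks (<) u" using * by simp
    ultimately show "u ! Suc i \<le> u ! i" by (auto simp: breaks_def)
  qed simp
next
  assume *: "dlist (mset u) = u"
  have "\<not> u ! (i - 1) < u ! i" if "i \<in> {1..<length u}" for i
    using dlist_antimono[of "i - 1" i "mset u"] that * by simp
  then show "breaks (<) u = {}" unfolding breaks_def by blast
qed

lemma sum_no_breaks:
  fixes b :: "nat multiset"
  shows "(\<Sum>v\<in>permutations_of_multiset b. of_bool (breaks (<) v = {})) = (1 :: real)"
proof -
  have "(\<Sum>v\<in>permutations_of_multiset b. of_bool (breaks (<) v = {})) = (\<Sum>v\<in>{dlist b}. 1 :: real)"
    by (rule sum.mono_neutral_cong_right)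
       (auto simp: breaks_less_empty_iff dest: permutations_of_multisetD intro: permutations_of_multisetI)
  then show ?thesis by simp
qed

text \<open>A prefix without ascents is the decreasing arrangement of its content, so the word is
  determined by its suffix, whose content is \<open>c\<close>.\<close>

lemma sum_breaks_split:
  fixes b :: "nat multiset"
  assumes "size b = n" "m \<le> n"
  shows "(\<Sum>v\<in>permutations_of_multiset b. of_bool (breaks (<) (take m v) = {}) * of_bool (breaks (<) (drop m v) = E)) =
    (\<Sum>c | c \<subseteq># b \<and> size c = n - m. \<Sum>w\<in>permutations_of_multiset c. of_bool (breaks (<) w = E) :: real)"
proof -
  let ?C = "{c. c \<subseteq># b \<and> size c = n - m}"
  have fin: "finite ?C" using finite_submultisets[of b] by simp
  have "(\<Sum>v\<in>permutations_of_multiset b. of_bool (breaks (<) (take m v) = {}) * of_bool (breaks (<) (drop m v) = E)) =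
      (\<Sum>v\<in>{v \<in> permutations_of_multiset b. breaks (<) (take m v) = {}}. of_bool (breaks (<) (drop m v) = E) :: real)"
    by (rule sum.mono_neutral_cong_right) auto
  also have "\<dots> = (\<Sum>(c, w)\<in>(SIGMA c:?C. permutations_of_multiset c). of_bool (breaks (<) w = E))"
  proof (rule sum.reindex_bij_witness[where i = "\<lambda>(c, w). dlist (b - c) @ w" and j = "\<lambda>v. (mset (drop m v), drop m v)"])
    fix v assume "v \<in> {v \<in> permutations_of_multiset b. breaks (<) (take m v) = {}}"
    then have v: "mset v = b" "breaks (<) (take m v) = {}" by (auto dest: permutations_of_multisetD)
    have "mset (take m v) + mset (drop m v) = b" using v(1) by (metis append_take_drop_id mset_append)
    then have sub: "mset (drop m v) \<subseteq># b" "b - mset (drop m v) = mset (take m v)" by auto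
    then show "(case (mset (drop m v), drop m v) of (c, w) \<Rightarrow> dlist (b - c) @ w) = v"
      using v(2) by (simp add: breaks_less_empty_iff)
    show "(mset (drop m v), drop m v) \<in> (SIGMA c:?C. permutations_of_multiset c)"
      using sub v(1) assms(1) by (auto intro: permutations_of_multisetI)
  next
    fix x assume "x \<in> (SIGMA c:?C. permutations_of_multiset c)"
    then obtain c w where x: "x = (c, w)" "c \<subseteq># b" "size c = n - m" "mset w = c"
      by (auto dest: permutations_of_multisetD)
    then have len: "length (dlist (b - c)) = m" using assms by (simp add: size_Diff_submset)
    then show "(mset (drop m (case x of (c, w) \<Rightarrow> dlist (b - c) @ w)), drop m (case x of (c, w) \<Rightarrow> dlist (b - c) @ w)) = x"
      using x by simp
    show "(case x of (c, w) \<Rightarrow> dlist (b - c) @ w) \<in> {v \<in> permutations_of_multiset b. breaks (<) (take m v) = {}}"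
      using x len by (auto simp: breaks_less_empty_iff intro!: permutations_of_multisetI)
  qed auto
  also have "\<dots> = (\<Sum>c\<in>?C. \<Sum>w\<in>permutations_of_multiset c. of_bool (breaks (<) w = E))"
    using fin by (subst sum.Sigma) auto
  finally show ?thesis .
qed

section \<open>Recursion for the major index of the inverse\<close>

definition imaj_des :: "real \<Rightarrow> nat \<Rightarrow> nat set \<Rightarrow> real" where
  "imaj_des q n D = (\<Sum>\<tau> | \<tau> permutes {1..n}. of_bool (DES n \<tau> = D) * q ^ maj n (inv \<tau>)) / qpoch q n"

lemma q_has_sum_imaj_des:
  assumes "0 < q" "q < 1"
  shows "q_has_sum q (\<lambda>b. \<Sum>v\<in>permutations_of_multiset b. of_bool (breaks (<) v = D)) n (imaj_des q n D)"
  unfolding imaj_des_def using q_has_sum_breaks[OF assms, of "\<lambda>E. of_bool (E = D)"] .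

lemma imaj_des_empty:
  assumes "0 < q" "q < 1"
  shows "imaj_des q n {} = 1 / qpoch q n"
  using q_has_sum_imaj_des[OF assms, of "{}" n] q_has_sum_1[OF assms, of n]
  unfolding sum_no_breaks by (rule q_has_sum_unique)

text \<open>Words with ascent set \<open>D\<close> or \<open>D - {m}\<close> are cut after the first
  run. The suffix is a word over a submultiset of size n - m, and
  \<open>q_has_sum_submultisets\<close> supplies the factor \<open>1 / qpoch q m\<close>.\<close>

lemma imaj_des_split:
  assumes q: "0 < q" "q < 1" and D: "D \<subseteq> {1..<n}" "D \<noteq> {}" "m = Min D"
  shows "imaj_des q n D + imaj_des q n (D - {m}) = imaj_des q (n - m) (shift_down m D) / qpoch q m"
proof (rule q_has_sum_unique)
  have "finite D" using D(1) finite_subset by blast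
  then have "m \<in> D" using D by simp
  then have mn: "m \<le> n" using D(1) by auto
  show "q_has_sum q (\<lambda>b. (\<Sum>v\<in>permutations_of_multiset b. of_bool (breaks (<) v = D)) +
      (\<Sum>v\<in>permutations_of_multiset b. of_bool (breaks (<) v = D - {m}))) n
      (imaj_des q n D + imaj_des q n (D - {m}))"
    by (intro q_has_sum_add q_has_sum_imaj_des q)
  have "q_has_sum q (\<lambda>b. \<Sum>c | c \<subseteq># b \<and> size c = n - m. \<Sum>w\<in>permutations_of_multiset c.
      of_bool (breaks (<) w = shift_down m D)) n (imaj_des q (n - m) (shift_down m D) / qpoch q (n - (n - m)))"
    by (intro q_has_sum_submultisets q_has_sum_imaj_des q) (auto intro: sum_nonneg)
  moreover have "(\<Sum>c | c \<subseteq># b \<and> size c = n - m. \<Sum>w\<in>permutations_of_multiset c.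
      of_bool (breaks (<) w = shift_down m D)) =
      (\<Sum>v\<in>permutations_of_multiset b. of_bool (breaks (<) v = D)) +
      (\<Sum>v\<in>permutations_of_multiset b. of_bool (breaks (<) v = D - {m}) :: real)" if "size b = n" for b :: "nat multiset"
    unfolding sum_breaks_split[OF that mn, symmetric] sum.distrib[symmetric]
    using D that by (intro sum.cong refl of_bool_breaks_split[symmetric])
      (auto dest!: permutations_of_multisetD)
  ultimately show "q_has_sum q (\<lambda>b. (\<Sum>v\<in>permutations_of_multiset b. of_bool (breaks (<) v = D)) +
      (\<Sum>v\<in>permutations_of_multiset b. of_bool (breaks (<) v = D - {m}))) n
      (imaj_des q (n - m) (shift_down m D) / qpoch q m)"
    using mn by (subst (asm) q_has_sum_cong) auto
qed

section \<open>Recursion for inversions through Lehmer codes\<close>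

fun lehmer :: "nat list \<Rightarrow> nat list" where
  "lehmer [] = []"
| "lehmer (x # xs) = length (filter (\<lambda>z. z < x) xs) # lehmer xs"

lemma lehmer_eq_Nil_iff [simp]: "lehmer xs = [] \<longleftrightarrow> xs = []"
  by (cases xs) auto

text \<open>For neighbours x, y with y < x, the code entry of x counts y itself and everything
  counted for y. Otherwise it counts at most what is counted for y.\<close>

lemma breaks_lehmer: "breaks (>) (lehmer xs) = breaks (>) xs"
proof (induction xs)
  case (Cons x xs)
  show ?case
  proof (cases xs)
    case (Cons y ys)
    have "length (filter (\<lambda>z. z < y) ys) < length (filter (\<lambda>z. z < x) xs) \<longleftrightarrow> y < x"
    proof (cases "y < x")
      case True
      then have "length (filter (\<lambda>z. z < y) ys) \<le> length (filter (\<lambda>z. z < x) ys)"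
        by (induction ys) auto
      then show ?thesis using True Cons by simp
    next
      case False
      then have "length (filter (\<lambda>z. z < x) ys) \<le> length (filter (\<lambda>z. z < y) ys)"
        by (induction ys) auto
      then show ?thesis using False Cons by simp
    qed
    then show ?thesis using Cons.IH Cons by (simp add: breaks_Cons)
  qed (simp add: breaks_Cons)
qed simp

lemma sum_list_lehmer:
  "card {(i, j). i < j \<and> j < length xs \<and> xs ! j < xs ! i} = sum_list (lehmer xs)"
proof (induction xs)
  case (Cons x xs)
  let ?I = "{(i, j). i < j \<and> j < length xs \<and> xs ! j < xs ! i}"
  let ?J = "{j. j < length xs \<and> xs ! j < x}"
  have fin: "finite ?I" by (rule finite_subset[of _ "{..<length xs} \<times> {..<length xs}"]) auto
  have "{(i, j). i < j \<and> j < length (x # xs) \<and> (x # xs) ! j < (x # xs) ! i} =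
      (\<lambda>j. (0, Suc j)) ` ?J \<union> map_prod Suc Suc ` ?I" (is "?K = _")
  proof (rule set_eqI, clarify)
    fix i j
    show "(i, j) \<in> ?K \<longleftrightarrow> (i, j) \<in> (\<lambda>j. (0, Suc j)) ` ?J \<union> map_prod Suc Suc ` ?I"
      by (cases i; cases j) (auto simp: image_iff)
  qed
  moreover have "card (\<dots>) = card ?J + card ?I"
    using fin by (subst card_Un_disjoint) (auto simp: card_image inj_on_def)
  ultimately show ?case by (simp add: Cons.IH length_filter_conv_card)
qed simp

definition lehmer_codes :: "nat \<Rightarrow> nat list set" where
  "lehmer_codes n = {L. length L = n \<and> (\<forall>i<n. L ! i + i < n)}"

lemma lehmer_codes_Suc_bij: "bij_betw (\<lambda>(r, L). r # L) ({..n} \<times> lehmer_codes n) (lehmer_codes (Suc n))"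
proof (rule bij_betwI[where g = "\<lambda>L. (hd L, tl L)"])
  show "(\<lambda>(r, L). r # L) \<in> {..n} \<times> lehmer_codes n \<rightarrow> lehmer_codes (Suc n)"
    by (auto simp: lehmer_codes_def nth_Cons split: nat.splits)
  show "(\<lambda>L. (hd L, tl L)) \<in> lehmer_codes (Suc n) \<rightarrow> {..n} \<times> lehmer_codes n"
  proof
    fix L assume L: "L \<in> lehmer_codes (Suc n)"
    then obtain r K where [simp]: "L = r # K" by (cases L) (auto simp: lehmer_codes_def)
    have "(r # K) ! i + i < Suc n" if "i < Suc n" for i using L that by (simp add: lehmer_codes_def)
    from this[of 0] this[of "Suc _"] show "(hd L, tl L) \<in> {..n} \<times> lehmer_codes n"
      using L by (auto simp: lehmer_codes_def)
  qed
  show "(case (hd L, tl L) of (r, L) \<Rightarrow> r # L) = L" if "L \<in> lehmer_codes (Suc n)" for L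
    using that by (cases L) (auto simp: lehmer_codes_def)
qed auto

lemma finite_lehmer_codes [simp]: "finite (lehmer_codes n)"
proof (induction n)
  case (Suc n)
  then show ?case using bij_betw_finite[OF lehmer_codes_Suc_bij, of n] by simp
next
  case 0
  show ?case by (simp add: lehmer_codes_def)
qed

text \<open>The first code entry is the rank of the first letter in \<open>S\<close>, and ranks map
  \<open>S\<close> bijectively onto \<open>{..n}\<close>. Arbitrary finite \<open>S\<close> are
  allowed because the induction removes that letter.\<close>

lemma sum_lehmer:
  fixes g :: "nat list \<Rightarrow> real"
  assumes "finite S"
  shows "(\<Sum>xs\<in>permutations_of_set S. g (lehmer xs)) = (\<Sum>L\<in>lehmer_codes (card S). g L)"
  using assms
proof (induction "card S" arbitrary: S g)
  case 0
  then have "S = {}" by simp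
  moreover have "lehmer_codes 0 = {[]}" by (auto simp: lehmer_codes_def)
  ultimately show ?case by simp
next
  case (Suc n)
  let ?rank = "\<lambda>x. card {z \<in> S. z < x}"
  have ne: "S \<noteq> {}" using Suc.hyps(2) by auto
  have rank_less: "?rank x < ?rank y" if "x < y" "x \<in> S" for x y
    using that Suc.prems by (intro psubset_card_mono) auto
  have inj: "inj_on ?rank S"
    by (rule linorder_inj_onI) (use rank_less in \<open>auto simp: neq_iff\<close>)
  have "?rank x < card S" if "x \<in> S" for x
    using that Suc.prems by (intro psubset_card_mono) auto
  then have "?rank ` S \<subseteq> {..n}" using Suc.hyps(2) by fastforce
  then have "?rank ` S = {..n}"
    using inj Suc.hyps(2) by (intro card_subset_eq) (auto simp: card_image)
  with inj have bij: "bij_betw ?rank S {..n}" by (simp add: bij_betw_def)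
  have "(\<Sum>xs\<in>permutations_of_set S. g (lehmer xs)) =
      (\<Sum>x\<in>S. \<Sum>xs\<in>(#) x ` permutations_of_set (S - {x}). g (lehmer xs))"
    unfolding permutations_of_set_nonempty[OF ne] by (rule sum.UNION_disjoint) (use Suc.prems in auto)
  also have "\<dots> = (\<Sum>x\<in>S. \<Sum>xs\<in>permutations_of_set (S - {x}). g (?rank x # lehmer xs))"
  proof (rule sum.cong[OF refl])
    fix x assume "x \<in> S"
    have "length (filter (\<lambda>z. z < x) xs) = ?rank x" if "xs \<in> permutations_of_set (S - {x})" for xs
    proof -
      have "distinct xs" "set xs = S - {x}" using that by (auto dest: permutations_of_setD)
      moreover have "{z. z < x} \<inter> (S - {x}) = {z \<in> S. z < x}" by auto
      ultimately show ?thesis by (simp add: distinct_length_filter)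
    qed
    then show "(\<Sum>xs\<in>(#) x ` permutations_of_set (S - {x}). g (lehmer xs)) =
        (\<Sum>xs\<in>permutations_of_set (S - {x}). g (?rank x # lehmer xs))"
      by (simp add: sum.reindex)
  qed
  also have "\<dots> = (\<Sum>x\<in>S. \<Sum>L\<in>lehmer_codes n. g (?rank x # L))"
  proof (rule sum.cong[OF refl])
    fix x assume "x \<in> S"
    then have "n = card (S - {x})" using Suc.hyps(2) Suc.prems by simp
    then show "(\<Sum>xs\<in>permutations_of_set (S - {x}). g (?rank x # lehmer xs)) = (\<Sum>L\<in>lehmer_codes n. g (?rank x # L))"
      using Suc.hyps(1)[of "S - {x}" "\<lambda>L. g (?rank x # L)"] Suc.prems by simp
  qed
  also have "\<dots> = (\<Sum>r\<le>n. \<Sum>L\<in>lehmer_codes n. g (r # L))"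
    by (rule sum.reindex_bij_betw[OF bij])
  also have "\<dots> = (\<Sum>L\<in>lehmer_codes (Suc n). g L)"
    using sum.reindex_bij_betw[OF lehmer_codes_Suc_bij, of g n]
    by (simp add: sum.cartesian_product case_prod_unfold)
  finally show ?case using Suc.hyps(2) by simp
qed

lemma bij_betw_map_word:
  "bij_betw (\<lambda>\<tau>. map_word n \<tau>) {\<tau>. \<tau> permutes {1..n}} (permutations_of_set {1..n})"
proof -
  let ?P = "{\<tau>. \<tau> permutes {1..n}}"
  have inj: "inj_on (\<lambda>\<tau>. map_word n \<tau>) ?P"
  proof (rule inj_onI)
    fix \<tau> \<rho> assume *: "\<tau> \<in> ?P" "\<rho> \<in> ?P" "map_word n \<tau> = map_word n \<rho>"
    then have "\<tau> i = \<rho> i" if "i \<in> {1..n}" for i using that by (simp only: map_word_eq_iff)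
    moreover have "\<tau> i = \<rho> i" if "i \<notin> {1..n}" for i
      using that * by (simp add: permutes_not_in)
    ultimately show "\<tau> = \<rho>" by blast
  qed
  have "map_word n \<tau> \<in> permutations_of_set {1..n}" if "\<tau> \<in> ?P" for \<tau>
  proof
    have perm: "\<tau> permutes {1..n}" using that by simp
    show "set (map_word n \<tau>) = {1..n}"
      using permutes_image[OF perm] by (simp only: set_map set_upt atLeastLessThanSuc_atLeastAtMost)
    show "distinct (map_word n \<tau>)"
      using permutes_inj_on[OF perm] by (simp add: distinct_map del: upt_Suc)
  qed
  then have "(\<lambda>\<tau>. map_word n \<tau>) ` ?P = permutations_of_set {1..n}"
    using inj by (intro card_subset_eq) (auto simp: card_image card_permutations[OF refl] simp del: upt_Suc)
  with inj show ?thesis by (simp add: bij_betw_def)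
qed

lemma inv_count_eq: "inv_count n \<tau> = sum_list (lehmer (map_word n \<tau>))"
proof -
  let ?J = "{(i, j). i < j \<and> j < length (map_word n \<tau>) \<and> map_word n \<tau> ! j < map_word n \<tau> ! i}"
  have "bij_betw (map_prod Suc Suc) ?J {(i, j). 1 \<le> i \<and> i < j \<and> j \<le> n \<and> \<tau> i > \<tau> j}"
    by (rule bij_betwI[where g = "map_prod (\<lambda>i. i - 1) (\<lambda>i. i - 1)"]) (auto simp del: upt_Suc)
  then show ?thesis unfolding inv_count_def sum_list_lehmer[symmetric] by (simp only: bij_betw_same_card)
qed

lemma DES_eq_breaks: "DES n \<tau> = breaks (>) (map_word n \<tau>)"
  by (auto simp: DES_def breaks_def simp del: upt_Suc)

definition inv_des :: "real \<Rightarrow> nat \<Rightarrow> nat set \<Rightarrow> real" where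
  "inv_des q n D = (\<Sum>\<tau> | \<tau> permutes {1..n}. of_bool (DES n \<tau> = D) * q ^ inv_count n \<tau>) / qpoch q n"

lemma inv_des_eq_codes:
  "inv_des q n D = (\<Sum>L\<in>lehmer_codes n. of_bool (breaks (>) L = D) * q ^ sum_list L) / qpoch q n"
proof -
  let ?g = "\<lambda>L. of_bool (breaks (>) L = D) * q ^ sum_list L"
  have "(\<Sum>\<tau> | \<tau> permutes {1..n}. of_bool (DES n \<tau> = D) * q ^ inv_count n \<tau>) =
      (\<Sum>\<tau> | \<tau> permutes {1..n}. ?g (lehmer (map_word n \<tau>)))"
    by (intro sum.cong refl) (simp only: DES_eq_breaks inv_count_eq breaks_lehmer)
  also have "\<dots> = (\<Sum>xs\<in>permutations_of_set {1..n}. ?g (lehmer xs))"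
    by (rule sum.reindex_bij_betw[OF bij_betw_map_word])
  also have "\<dots> = (\<Sum>L\<in>lehmer_codes n. ?g L)"
    using sum_lehmer[of "{1..n}" ?g] by simp
  finally show ?thesis by (simp add: inv_des_def)
qed

text \<open>Partitions inside an m by N box, with zero parts allowed.\<close>

definition weak_chains :: "nat \<Rightarrow> nat \<Rightarrow> nat list set" where
  "weak_chains m N = {u. length u = m \<and> sorted u \<and> (\<forall>x\<in>set u. x \<le> N)}"

lemma finite_weak_chains [simp]: "finite (weak_chains m N)"
  by (rule finite_subset[OF _ finite_lists_length_eq[of "{..N}" m]]) (auto simp: weak_chains_def)

lemma weak_chains_Suc_Suc:
  "weak_chains (Suc m) (Suc N) = (#) 0 ` weak_chains m (Suc N) \<union> map Suc ` weak_chains (Suc m) N"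
proof (intro equalityI subsetI)
  fix u assume u: "u \<in> weak_chains (Suc m) (Suc N)"
  show "u \<in> (#) 0 ` weak_chains m (Suc N) \<union> map Suc ` weak_chains (Suc m) N"
  proof (cases "hd u = 0")
    case True
    then show ?thesis using u by (cases u) (auto simp: weak_chains_def)
  next
    case False
    have pos: "1 \<le> x" if "x \<in> set u" for x
      using u that False by (cases u) (auto simp: weak_chains_def)
    then have "map (Suc \<circ> (\<lambda>x. x - 1)) u = u" by (intro map_idI) force
    then have "u = map Suc (map (\<lambda>x. x - 1) u)" by simp
    moreover have "sorted (map (\<lambda>x. x - 1) u)"
      using u by (auto simp: weak_chains_def sorted_iff_nth_mono intro: diff_le_mono)
    then have "map (\<lambda>x. x - 1) u \<in> weak_chains (Suc m) N"
      using u by (auto simp: weak_chains_def)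
    ultimately show ?thesis by blast
  qed
qed (auto simp: weak_chains_def sorted_iff_nth_mono nth_Cons split: nat.splits)

text \<open>The Gaussian binomial coefficient. Lists starting with 0 and lists with only positive
  entries give the two terms of the q-Pascal recursion, hence the double induction.\<close>

lemma sum_weak_chains:
  assumes "0 < q" "q < 1"
  shows "(\<Sum>u\<in>weak_chains m N. q ^ sum_list u) = qpoch q (m + N) / (qpoch q m * qpoch q N)"
proof (induction m arbitrary: N)
  case 0
  have "weak_chains 0 N = {[]}" by (auto simp: weak_chains_def)
  then show ?case using qpoch_pos[OF assms, of N] by simp
next
  case (Suc m)
  note IH = Suc.IH
  show ?case
  proof (induction N)
    case 0
    have "u = replicate (Suc m) 0" if "u \<in> weak_chains (Suc m) 0" for u
      using that by (intro replicate_eqI) (auto simp: weak_chains_def)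
    then have "weak_chains (Suc m) 0 = {replicate (Suc m) 0}"
      by (auto simp: weak_chains_def sorted_replicate simp del: replicate.simps)
    then show ?case using qpoch_pos[OF assms, of "Suc m"] by (simp add: sum_list_replicate)
  next
    case (Suc N)
    have pos: "qpoch q m > 0" "qpoch q N > 0" "1 - q ^ Suc m > 0" "1 - q ^ Suc N > 0"
      using qpoch_pos[OF assms] power_Suc_less_one[OF assms] by auto
    have frac: "X / (A * (B * b)) + p * (X / (A * a * B)) = X * (a + p * b) / (A * a * (B * b))"
      if "A \<noteq> 0" "B \<noteq> 0" "a \<noteq> 0" "b \<noteq> 0" for X A B a b p :: real
      using that by (simp add: field_simps)
    have "(\<Sum>u\<in>weak_chains (Suc m) (Suc N). q ^ sum_list u) =
        (\<Sum>u\<in>(#) 0 ` weak_chains m (Suc N). q ^ sum_list u) + (\<Sum>u\<in>map Suc ` weak_chains (Suc m) N. q ^ sum_list u)"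
      unfolding weak_chains_Suc_Suc by (rule sum.union_disjoint) auto
    also have "(\<Sum>u\<in>(#) 0 ` weak_chains m (Suc N). q ^ sum_list u) = (\<Sum>u\<in>weak_chains m (Suc N). q ^ sum_list u)"
      by (simp add: sum.reindex)
    also have "(\<Sum>u\<in>map Suc ` weak_chains (Suc m) N. q ^ sum_list u) =
        (\<Sum>u\<in>weak_chains (Suc m) N. q ^ Suc m * q ^ sum_list u)"
    proof -
      have "sum_list (map Suc u) = Suc m + sum_list u" if "u \<in> weak_chains (Suc m) N" for u
        using sum_list_map_add[of 1 u] that by (simp add: weak_chains_def)
      then show ?thesis by (simp add: sum.reindex inj_on_def power_add mult.assoc)
    qed
    also have "\<dots> = q ^ Suc m * (qpoch q (Suc m + N) / (qpoch q (Suc m) * qpoch q N))"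
      by (simp only: sum_distrib_left[symmetric] Suc.IH)
    also have "(\<Sum>u\<in>weak_chains m (Suc N). q ^ sum_list u) = qpoch q (Suc m + N) / (qpoch q m * qpoch q (Suc N))"
      using IH[of "Suc N"] by simp
    also have "qpoch q (Suc m + N) / (qpoch q m * qpoch q (Suc N)) +
        q ^ Suc m * (qpoch q (Suc m + N) / (qpoch q (Suc m) * qpoch q N)) =
        qpoch q (Suc m + N) * ((1 - q ^ Suc m) + q ^ Suc m * (1 - q ^ Suc N)) /
        (qpoch q m * (1 - q ^ Suc m) * (qpoch q N * (1 - q ^ Suc N)))"
      unfolding qpoch_Suc[of q m] qpoch_Suc[of q N] using pos by (intro frac) auto
    also have "(1 - q ^ Suc m) + q ^ Suc m * (1 - q ^ Suc N) = 1 - q ^ Suc (Suc m + N)"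
      by (simp add: algebra_simps power_add)
    finally show ?case by (simp only: qpoch_Suc add_Suc_right)
  qed
qed

lemma breaks_greater_empty_iff: "breaks (>) u = {} \<longleftrightarrow> sorted (u :: nat list)"
proof -
  have "breaks (>) u = {} \<longleftrightarrow> (\<forall>i\<in>{1..<length u}. u ! (i - 1) \<le> u ! i)"
    by (auto simp: breaks_def not_less)
  also have "\<dots> \<longleftrightarrow> (\<forall>i. Suc i < length u \<longrightarrow> u ! i \<le> u ! Suc i)"
  proof (intro iffI allI impI ballI)
    fix i assume *: "\<forall>i\<in>{1..<length u}. u ! (i - 1) \<le> u ! i" and "Suc i < length u"
    then show "u ! i \<le> u ! Suc i" using bspec[OF *, of "Suc i"] by simp
  next
    fix i assume *: "\<forall>i. Suc i < length u \<longrightarrow> u ! i \<le> u ! Suc i" and i: "i \<in> {1..<length u}"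
    then show "u ! (i - 1) \<le> u ! i" using *[rule_format, of "i - 1"] by simp
  qed
  finally show ?thesis by (simp add: sorted_iff_nth_Suc)
qed

text \<open>In a weakly increasing prefix of length m, all bounds follow from that on the last
  entry, which has index m - 1 and is therefore at most n - m.\<close>

lemma lehmer_codes_split_bij:
  assumes "1 \<le> m" "m \<le> n"
  shows "bij_betw (\<lambda>(u, w). u @ w) (weak_chains m (n - m) \<times> lehmer_codes (n - m))
    {L \<in> lehmer_codes n. breaks (>) (take m L) = {}}"
proof (rule bij_betwI[where g = "\<lambda>L. (take m L, drop m L)"])
  show "(\<lambda>(u, w). u @ w) \<in> weak_chains m (n - m) \<times> lehmer_codes (n - m) \<rightarrow>
      {L \<in> lehmer_codes n. breaks (>) (take m L) = {}}"
  proof (intro funcsetI, clarify)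
    fix u w assume u: "u \<in> weak_chains m (n - m)" and w: "w \<in> lehmer_codes (n - m)"
    have "(u @ w) ! i + i < n" if "i < n" for i
    proof (cases "i < m")
      case True
      have len: "length u = m" using u by (simp add: weak_chains_def)
      then have "u ! i \<le> n - m" using u True by (simp add: weak_chains_def)
      then show ?thesis using True len assms by (simp add: nth_append)
    next
      case False
      then have "i - m < n - m" using that by simp
      then have "w ! (i - m) + (i - m) < n - m" using w unfolding lehmer_codes_def by blast
      then show ?thesis using False u by (auto simp: nth_append weak_chains_def)
    qed
    then show "u @ w \<in> lehmer_codes n \<and> breaks (>) (take m (u @ w)) = {}"
      using u w assms by (auto simp: lehmer_codes_def weak_chains_def breaks_greater_empty_iff)
  qed
  show "(\<lambda>L. (take m L, drop m L)) \<in> {L \<in> lehmer_codes n. breaks (>) (take m L) = {}} \<rightarrow>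
      weak_chains m (n - m) \<times> lehmer_codes (n - m)"
  proof (intro funcsetI)
    fix L assume "L \<in> {L \<in> lehmer_codes n. breaks (>) (take m L) = {}}"
    then have L: "length L = n" "\<And>i. i < n \<Longrightarrow> L ! i + i < n" and sorted: "sorted (take m L)"
      by (auto simp: lehmer_codes_def breaks_greater_empty_iff)
    have "x \<le> n - m" if mem: "x \<in> set (take m L)" for x
    proof -
      obtain i where "i < length (take m L)" and x: "take m L ! i = x"
        using mem unfolding in_set_conv_nth by blast
      then have i: "i < m" "x = take m L ! i" by simp_all
      have "take m L ! i \<le> take m L ! (m - 1)"
        using i L(1) assms by (intro sorted_nth_mono[OF sorted]) auto
      moreover have "L ! (m - 1) + (m - 1) < n" using assms by (intro L(2)) auto
      ultimately show ?thesis using i assms by auto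
    qed
    moreover have "drop m L \<in> lehmer_codes (n - m)"
    proof -
      have "L ! (m + i) + i < n - m" if "i < n - m" for i
        using L(2)[of "m + i"] that by linarith
      then show ?thesis using L(1) assms by (simp add: lehmer_codes_def)
    qed
    ultimately show "(take m L, drop m L) \<in> weak_chains m (n - m) \<times> lehmer_codes (n - m)"
      using sorted L(1) assms by (auto simp: weak_chains_def)
  qed
qed (auto simp: weak_chains_def)

text \<open>The same recursion as \<open>imaj_des_split\<close>: prefix and suffix of the code are
  independent, and the Gaussian binomial of the prefix cancels against the denominators.\<close>

lemma inv_des_split:
  assumes q: "0 < q" "q < 1" and D: "D \<subseteq> {1..<n}" "D \<noteq> {}" "m = Min D"
  shows "inv_des q n D + inv_des q n (D - {m}) = inv_des q (n - m) (shift_down m D) / qpoch q m"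
proof -
  let ?E = "shift_down m D"
  have "finite D" using D(1) finite_subset by blast
  then have "m \<in> D" using D by simp
  then have mn: "1 \<le> m" "m \<le> n" using D(1) by auto
  have pos: "qpoch q k > 0" for k by (rule qpoch_pos[OF q])
  have "(\<Sum>L\<in>lehmer_codes n. of_bool (breaks (>) L = D) * q ^ sum_list L) +
      (\<Sum>L\<in>lehmer_codes n. of_bool (breaks (>) L = D - {m}) * q ^ sum_list L) =
      (\<Sum>L\<in>lehmer_codes n. of_bool (breaks (>) (take m L) = {}) * of_bool (breaks (>) (drop m L) = ?E) * q ^ sum_list L)"
    unfolding sum.distrib[symmetric] distrib_right[symmetric]
  proof (intro sum.cong refl arg_cong2[of _ _ _ _ "(*)"])
    fix L assume "L \<in> lehmer_codes n"
    then show "of_bool (breaks (>) L = D) + of_bool (breaks (>) L = D - {m}) =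
        (of_bool (breaks (>) (take m L) = {}) * of_bool (breaks (>) (drop m L) = ?E) :: real)"
      using D by (intro of_bool_breaks_split) (auto simp: lehmer_codes_def)
  qed
  also have "\<dots> = (\<Sum>L\<in>{L \<in> lehmer_codes n. breaks (>) (take m L) = {}}.
      of_bool (breaks (>) (drop m L) = ?E) * q ^ sum_list L)"
    by (rule sum.mono_neutral_cong_right) auto
  also have "\<dots> = (\<Sum>(u, w)\<in>weak_chains m (n - m) \<times> lehmer_codes (n - m).
      of_bool (breaks (>) (drop m (u @ w)) = ?E) * q ^ sum_list (u @ w))"
    using sum.reindex_bij_betw[OF lehmer_codes_split_bij[OF mn],
        of "\<lambda>L. of_bool (breaks (>) (drop m L) = ?E) * q ^ sum_list L"]
    by (simp add: case_prod_unfold)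
  also have "\<dots> = (\<Sum>(u, w)\<in>weak_chains m (n - m) \<times> lehmer_codes (n - m).
      q ^ sum_list u * (of_bool (breaks (>) w = ?E) * q ^ sum_list w))"
    by (intro sum.cong refl) (auto simp: weak_chains_def power_add)
  also have "\<dots> = (\<Sum>u\<in>weak_chains m (n - m). q ^ sum_list u) *
      (\<Sum>w\<in>lehmer_codes (n - m). of_bool (breaks (>) w = ?E) * q ^ sum_list w)"
    unfolding sum_product sum.cartesian_product ..
  also have "(\<Sum>u\<in>weak_chains m (n - m). q ^ sum_list u) = qpoch q n / (qpoch q m * qpoch q (n - m))"
    using sum_weak_chains[OF q, of m "n - m"] mn by simp
  finally show ?thesis
    unfolding inv_des_eq_codes add_divide_distrib[symmetric] using pos[of n] pos[of m] pos[of "n - m"]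
    by (simp add: field_simps)
qed

text \<open>The last entry of a Lehmer code is 0, so the only weakly increasing code is the zero
  code.\<close>

lemma inv_des_empty: "inv_des q n {} = 1 / qpoch q n"
proof -
  have "L = replicate n 0" if "L \<in> lehmer_codes n" "sorted L" for L
  proof (intro replicate_eqI)
    show "x = 0" if "x \<in> set L" for x
    proof -
      have len: "length L = n" using \<open>L \<in> lehmer_codes n\<close> by (simp add: lehmer_codes_def)
      obtain i where i: "i < n" "x = L ! i" using \<open>x \<in> set L\<close> len by (auto simp: in_set_conv_nth)
      have "L ! i \<le> L ! (n - 1)" using i len \<open>sorted L\<close> by (intro sorted_nth_mono) auto
      moreover have "L ! (n - 1) + (n - 1) < n" 
      proof -
        have "n - 1 < n" using i(1) by simp
        then show ?thesis using \<open>L \<in> lehmer_codes n\<close> unfolding lehmer_codes_def by blast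
      qed
      ultimately show ?thesis using i by simp
    qed
  qed (use that in \<open>simp add: lehmer_codes_def\<close>)
  then have "(\<Sum>L\<in>lehmer_codes n. of_bool (breaks (>) L = {}) * q ^ sum_list L) =
      (\<Sum>L\<in>{replicate n 0}. q ^ sum_list L)"
    by (intro sum.mono_neutral_cong_right finite_lehmer_codes)
       (auto simp: breaks_greater_empty_iff sorted_replicate lehmer_codes_def)
  then show ?thesis by (simp add: inv_des_eq_codes sum_list_replicate)
qed

text \<open>Both \<open>D - {m}\<close> and \<open>shift_down m D\<close> have fewer elements than
  \<open>D\<close>, so the common recursion and the common value at the empty set determine
  everything.\<close>

lemma inv_des_eq_imaj_des:
  assumes q: "0 < q" "q < 1" and "D \<subseteq> {1..<n}"
  shows "inv_des q n D = imaj_des q n D"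
  using assms(3)
proof (induction "card D" arbitrary: n D rule: less_induct)
  case less
  show ?case
  proof (cases "D = {}")
    case True
    then show ?thesis by (simp add: inv_des_empty imaj_des_empty[OF q])
  next
    case False
    define m where "m = Min D"
    have fin: "finite D" using less.prems finite_subset by blast
    then have m: "m \<in> D" using False by (simp add: m_def)
    have "card (D - {m}) < card D" using fin m by (intro psubset_card_mono) auto
    then have 1: "inv_des q n (D - {m}) = imaj_des q n (D - {m})"
      using less.prems by (intro less.hyps) auto
    have sub: "(+) m ` shift_down m D \<subseteq> D - {m}" by (auto simp: shift_down_def)
    have "card (shift_down m D) = card ((+) m ` shift_down m D)" by (simp add: card_image)
    also have "\<dots> \<le> card (D - {m})" using fin by (intro card_mono sub) auto
    also have "\<dots> < card D" by fact
    finally have 2: "inv_des q (n - m) (shift_down m D) = imaj_des q (n - m) (shift_down m D)"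
      using less.prems by (intro less.hyps) (auto simp: shift_down_def)
    show ?thesis
      using inv_des_split[OF q less.prems False m_def] imaj_des_split[OF q less.prems False m_def] 1 2 by simp
  qed
qed

section \<open>The q-binomial-Eulerian polynomials\<close>

definition gapped :: "nat set \<Rightarrow> bool" where
  "gapped D \<longleftrightarrow> (\<forall>i\<in>D. Suc i \<notin> D)"

definition gamma_weight :: "real \<Rightarrow> nat \<Rightarrow> nat set \<Rightarrow> real" where
  "gamma_weight t n D = (if gapped D then t ^ card D * (1 + t) ^ (n - 2 * card D) else 0)"

text \<open>\<open>D\<close> and its shift by one are disjoint subsets of \<open>{1..n}\<close>. The
  bound keeps the exponent in \<open>gamma_weight\<close> from truncating.\<close>

lemma card_gapped:
  assumes "gapped D" "D \<subseteq> {1..<n}"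
  shows "2 * card D \<le> n"
proof -
  have fin: "finite D" using assms(2) finite_subset by blast
  have "card D + card (Suc ` D) = card (D \<union> Suc ` D)"
    using assms(1) fin by (subst card_Un_disjoint) (auto simp: gapped_def)
  also have "\<dots> \<le> card {1..n}" using assms(2) by (intro card_mono) auto
  finally show ?thesis by (simp add: card_image)
qed

lemma gapped_image_Suc: "gapped (Suc ` D) \<longleftrightarrow> gapped D"
  by (auto simp: gapped_def)

lemma gapped_insert_1: "0 \<notin> D \<Longrightarrow> gapped (insert 1 (Suc ` Suc ` D)) \<longleftrightarrow> gapped D"
  by (auto simp: gapped_def)

lemma breaks_subset: "breaks r v \<subseteq> {1..<length v}"
  by (auto simp: breaks_def)

text \<open>A good ascent at the front shifts the remaining ascents by two and adds position 1; a
  non-ascent shifts them by one and leaves one more factor \<open>1 + t\<close>.\<close>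

lemma asc_weight_eq_gamma_weight: "asc_weight t v = gamma_weight t (length v) (breaks (<) v)"
proof (induction t v rule: asc_weight.induct)
  case (3 t x y v)
  let ?B = "breaks (<) v"
  show ?case
  proof (cases "x < y")
    case False
    then have B: "breaks (<) (x # y # v) = Suc ` breaks (<) (y # v)" by (simp add: breaks_Cons[of _ x])
    have "gapped (breaks (<) (y # v)) \<Longrightarrow> 2 * card (breaks (<) (y # v)) \<le> Suc (length v)"
      using card_gapped[OF _ breaks_subset[of "(<)" "y # v"]] by simp
    then have "gamma_weight t (length (x # y # v)) (breaks (<) (x # y # v)) =
        (1 + t) * gamma_weight t (length (y # v)) (breaks (<) (y # v))"
      unfolding B gamma_weight_def gapped_image_Suc by (simp add: card_image Suc_diff_le)
    then show ?thesis using 3(2)[OF False] False by simp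
  next
    case True
    show ?thesis
    proof (cases "v \<noteq> [] \<and> y < hd v")
      case bad: True
      then have "{1, Suc 1} \<subseteq> breaks (<) (x # y # v)" using True by (simp add: breaks_Cons)
      then have "\<not> gapped (breaks (<) (x # y # v))" unfolding gapped_def by blast
      then show ?thesis using True bad by (simp add: gamma_weight_def)
    next
      case good: False
      then have B: "breaks (<) (x # y # v) = insert 1 (Suc ` Suc ` ?B)" using True by (auto simp: breaks_Cons)
      have "gapped (breaks (<) (x # y # v)) \<longleftrightarrow> gapped ?B"
        unfolding B by (rule gapped_insert_1) (simp add: breaks_def)
      moreover have "1 \<notin> Suc ` Suc ` ?B" by auto
      then have "card (breaks (<) (x # y # v)) = Suc (card ?B)"
        unfolding B by (simp add: card_image)
      ultimately have "gamma_weight t (length (x # y # v)) (breaks (<) (x # y # v)) = t * gamma_weight t (length v) ?B"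
        by (simp add: gamma_weight_def)
      then show ?thesis using 3(1)[OF True good] True good by auto
    qed
  qed
qed (simp_all add: gamma_weight_def gapped_def breaks_Cons)

definition excmaj_sum :: "real \<Rightarrow> real \<Rightarrow> nat \<Rightarrow> real" where
  "excmaj_sum q t n = (\<Sum>\<sigma> | \<sigma> permutes {1..n}. t ^ exc n \<sigma> * q ^ (maj n \<sigma> - exc n \<sigma>))"

text \<open>Read off from the expression as a sum over permutations; it licenses
  \<open>q_has_sum_submultisets\<close>.\<close>

lemma N_coeff_nonneg: "t \<ge> 0 \<Longrightarrow> N_coeff t b \<ge> 0"
  unfolding sum_exc_eq_N_coeff[OF refl, symmetric] by (intro sum_nonneg) auto

text \<open>The generating function of \<open>R_coeff\<close> is computed twice: by standardizing
  words, and from \<open>R_coeff_eq_sum_N_coeff\<close>. Uniqueness of sums equates the results,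
  which are then multiplied by \<open>qpoch q n\<close>.\<close>

lemma sum_gamma_weight_imaj:
  assumes q: "0 < q" "q < 1" and t: "0 < t" "t < 1"
  shows "(\<Sum>\<tau> | \<tau> permutes {1..n}. gamma_weight t n (DES n \<tau>) * q ^ maj n (inv \<tau>)) =
    1 + t * (\<Sum>m=1..n. qpoch q n / (qpoch q m * qpoch q (n - m)) * excmaj_sum q t m)"
proof -
  let ?x = "\<Sum>\<tau> | \<tau> permutes {1..n}. gamma_weight t n (DES n \<tau>) * q ^ maj n (inv \<tau>)"
  have "q_has_sum q (R_coeff t) n (?x / qpoch q n)"
  proof -
    have "(\<Sum>v\<in>permutations_of_multiset b. gamma_weight t n (breaks (<) v)) = R_coeff t b" if "size b = n" for b
      unfolding R_coeff_def asc_weight_eq_gamma_weight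
      using that by (intro sum.cong refl) (auto dest: permutations_of_multisetD)
    then show ?thesis
      using q_has_sum_breaks[OF q, of "gamma_weight t n" n] by (subst (asm) q_has_sum_cong) auto
  qed
  moreover have "q_has_sum q (R_coeff t) n
      (1 / qpoch q n + t * (\<Sum>m=1..n. excmaj_sum q t m / qpoch q m / qpoch q (n - m)))"
  proof -
    have "q_has_sum q (\<lambda>b. \<Sum>c | c \<subseteq># b \<and> size c = m. N_coeff t c) n (excmaj_sum q t m / qpoch q m / qpoch q (n - m))"
      if "m \<in> {1..n}" for m
      unfolding excmaj_sum_def using that t
      by (intro q_has_sum_submultisets q q_has_sum_N_coeff N_coeff_nonneg) auto
    then have "q_has_sum q (\<lambda>b. 1 + t * (\<Sum>m=1..n. \<Sum>c | c \<subseteq># b \<and> size c = m. N_coeff t c)) n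
        (1 / qpoch q n + t * (\<Sum>m=1..n. excmaj_sum q t m / qpoch q m / qpoch q (n - m)))"
      by (intro q_has_sum_add q_has_sum_1 q_has_sum_cmult q_has_sum_sum q)
    moreover have "1 + t * (\<Sum>m=1..n. \<Sum>c | c \<subseteq># b \<and> size c = m. N_coeff t c) = R_coeff t b" if "size b = n" for b
    proof -
      have fin: "finite {c. c \<subseteq># b \<and> c \<noteq> {#}}" using finite_submultisets[of b] by simp
      \<comment> \<open>The nonempty submultisets are grouped by size.\<close>
      have "(\<Sum>c | c \<subseteq># b \<and> c \<noteq> {#}. N_coeff t c) =
          (\<Sum>m=1..n. \<Sum>c | c \<in> {c. c \<subseteq># b \<and> c \<noteq> {#}} \<and> size c = m. N_coeff t c)"
      proof (rule sum.group[symmetric, OF fin])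
        show "size ` {c. c \<subseteq># b \<and> c \<noteq> {#}} \<subseteq> {1..n}"
          using that size_mset_mono by (auto simp: Suc_le_eq nonempty_has_size)
      qed simp
      also have "\<dots> = (\<Sum>m=1..n. \<Sum>c | c \<subseteq># b \<and> size c = m. N_coeff t c)"
        by (intro sum.cong refl) auto
      finally show ?thesis using R_coeff_eq_sum_N_coeff[of t b] t by simp
    qed
    ultimately show ?thesis by (subst (asm) q_has_sum_cong) auto
  qed
  ultimately have "?x / qpoch q n = 1 / qpoch q n + t * (\<Sum>m=1..n. excmaj_sum q t m / qpoch q m / qpoch q (n - m))"
    by (rule q_has_sum_unique)
  moreover have "qpoch q n \<noteq> 0" using qpoch_pos[OF q, of n] by simp
  then have "?x = qpoch q n * (?x / qpoch q n)" by simp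
  ultimately have "?x = qpoch q n * (1 / qpoch q n + t * (\<Sum>m=1..n. excmaj_sum q t m / qpoch q m / qpoch q (n - m)))"
    by (simp only:)
  also have "\<dots> = 1 + t * (\<Sum>m=1..n. qpoch q n * (excmaj_sum q t m / qpoch q m / qpoch q (n - m)))"
    using \<open>qpoch q n \<noteq> 0\<close> by (simp only: distrib_left sum_distrib_left mult.left_commute) simp
  finally show ?thesis by (simp add: mult_ac)
qed

text \<open>The two statistics are equidistributed on each descent class, so any weight depending
  only on the descent set may be inserted.\<close>

lemma sum_DES_inv_count_eq_imaj:
  fixes g :: "nat set \<Rightarrow> real"
  assumes q: "0 < q" "q < 1"
  shows "(\<Sum>\<tau> | \<tau> permutes {1..n}. g (DES n \<tau>) * q ^ inv_count n \<tau>) =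
    (\<Sum>\<tau> | \<tau> permutes {1..n}. g (DES n \<tau>) * q ^ maj n (inv \<tau>))"
proof -
  let ?P = "{\<tau>. \<tau> permutes {1..n}}" and ?T = "Pow {1..<n}"
  have group: "(\<Sum>\<tau>\<in>?P. g (DES n \<tau>) * f \<tau>) = (\<Sum>D\<in>?T. g D * (\<Sum>\<tau>\<in>?P. of_bool (DES n \<tau> = D) * f \<tau>))"
    for f :: "(nat \<Rightarrow> nat) \<Rightarrow> real"
  proof -
    have "DES n \<tau> \<in> ?T" for \<tau> using DES_subset[of n \<tau>] by blast
    then have "(\<Sum>\<tau>\<in>?P. g (DES n \<tau>) * f \<tau>) = (\<Sum>\<tau>\<in>?P. \<Sum>D\<in>?T. g D * (of_bool (DES n \<tau> = D) * f \<tau>))"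
      by (intro sum.cong refl) (simp add: of_bool_def if_distrib[of "\<lambda>x. _ * x"] if_distrib[of "\<lambda>x. x * _"] cong: if_cong)
    also have "\<dots> = (\<Sum>D\<in>?T. g D * (\<Sum>\<tau>\<in>?P. of_bool (DES n \<tau> = D) * f \<tau>))"
      unfolding sum_distrib_left by (rule sum.swap)
    finally show ?thesis .
  qed
  have "qpoch q n \<noteq> 0" using qpoch_pos[OF q, of n] by simp
  then have "(\<Sum>\<tau>\<in>?P. of_bool (DES n \<tau> = D) * q ^ inv_count n \<tau>) =
      (\<Sum>\<tau>\<in>?P. of_bool (DES n \<tau> = D) * q ^ maj n (inv \<tau>))" if "D \<in> ?T" for D
    using inv_des_eq_imaj_des[OF q, of D n] that by (simp add: inv_des_def imaj_des_def)
  then show ?thesis unfolding group by (intro sum.cong refl) simp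
qed

section \<open>Grouping permutations by the number of descents\<close>

lemma Gamma_tilde_iff:
  "\<sigma> \<in> Gamma_tilde n k \<longleftrightarrow> \<sigma> permutes {1..n} \<and> gapped (DES n \<sigma>) \<and> card (DES n \<sigma>) = k"
proof -
  have "double_descent n \<sigma> i \<longleftrightarrow> i \<in> DES n \<sigma> \<and> Suc i \<in> DES n \<sigma>" for i
    by (auto simp: double_descent_def DES_def)
  then show ?thesis by (auto simp: Gamma_tilde_def des_def gapped_def)
qed

lemma sum_Gamma_tilde:
  fixes f :: "(nat \<Rightarrow> nat) \<Rightarrow> real"
  shows "(\<Sum>\<sigma>\<in>Gamma_tilde n k. f \<sigma>) =
    (\<Sum>\<sigma> | \<sigma> permutes {1..n}. of_bool (gapped (DES n \<sigma>) \<and> card (DES n \<sigma>) = k) * f \<sigma>)"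
  by (rule sum.mono_neutral_cong_left) (auto simp: Gamma_tilde_iff finite_permutations)

lemma sum_gamma_weight_eq_Gamma_tilde:
  "(\<Sum>\<sigma> | \<sigma> permutes {1..n}. gamma_weight t n (DES n \<sigma>) * f \<sigma>) =
    (\<Sum>k=0..n div 2. (\<Sum>\<sigma>\<in>Gamma_tilde n k. f \<sigma>) * (t ^ k * (1 + t) ^ (n - 2 * k)))"
proof -
  have "gamma_weight t n (DES n \<sigma>) * f \<sigma> =
      (\<Sum>k=0..n div 2. of_bool (gapped (DES n \<sigma>) \<and> card (DES n \<sigma>) = k) * f \<sigma> * (t ^ k * (1 + t) ^ (n - 2 * k)))" for \<sigma>
  proof (cases "gapped (DES n \<sigma>)")
    case True
    then have "2 * card (DES n \<sigma>) \<le> n"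
      by (rule card_gapped) (use DES_subset[of n \<sigma>] in blast)
    then have "card (DES n \<sigma>) \<le> n div 2" by simp
    then show ?thesis using True
      by (simp add: gamma_weight_def of_bool_def if_distrib[of "\<lambda>x. x * _"] cong: if_cong)
  qed (simp add: gamma_weight_def)
  then show ?thesis
    unfolding sum_Gamma_tilde sum_distrib_right by (subst sum.swap) simp
qed

section \<open>Evaluation of polynomials at real points\<close>

lemma poly_q_int: "poly (q_int j) q * (1 - q) = 1 - q ^ j"
  using one_diff_power_eq[of q j] by (simp add: q_int_def poly_sum mult.commute)

lemma poly_q_fact: "poly (q_fact n) q * (1 - q) ^ n = qpoch q n"
proof (induction n)
  case (Suc n)
  have "poly (q_fact (Suc n)) q * (1 - q) ^ Suc n =
      (poly (q_int (Suc n)) q * (1 - q)) * (poly (q_fact n) q * (1 - q) ^ n)"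
    by (simp add: q_fact_Suc algebra_simps)
  then show ?case by (simp only: Suc.IH poly_q_int qpoch_Suc) (simp only: mult.commute)
qed (simp add: q_fact_def)

text \<open>Exactness turns the polynomial division into a product that can be evaluated; the powers
  of 1 - q in \<open>poly_q_fact\<close> balance.\<close>

lemma poly_q_binomial:
  assumes q: "0 < q" "q < 1" and "m \<le> n"
  shows "poly (q_binomial n m) q = qpoch q n / (qpoch q m * qpoch q (n - m))"
proof -
  have "(1 - q) ^ n = (1 - q) ^ m * (1 - q) ^ (n - m)" using assms(3) by (simp add: power_add[symmetric])
  then have "poly (q_binomial n m) q * (qpoch q m * qpoch q (n - m)) =
      poly (q_binomial n m * (q_fact m * q_fact (n - m))) q * (1 - q) ^ n"
    by (simp add: poly_q_fact[symmetric] mult_ac)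
  also have "\<dots> = qpoch q n" by (simp only: q_binomial_exact[OF assms(3)] poly_q_fact)
  finally show ?thesis using qpoch_pos[OF q, of m] qpoch_pos[OF q, of "n - m"] by (simp add: field_simps)
qed

lemma poly_eqI_unit_interval:
  fixes p r :: "real poly"
  assumes "\<And>x. 0 < x \<Longrightarrow> x < 1 \<Longrightarrow> poly p x = poly r x"
  shows "p = r"
proof (rule ccontr)
  assume "p \<noteq> r"
  then have "finite {x. poly (p - r) x = 0}" by (intro poly_roots_finite) simp
  moreover have "{0<..<1} \<subseteq> {x. poly (p - r) x = 0}" using assms by auto
  ultimately have "finite {0<..<1::real}" by (rule finite_subset[rotated])
  then show False using infinite_Ioo[of 0 "1::real"] by simp
qed

text \<open>Over the domain of real polynomials in q, the constants \<open>[:t:]\<close> with t in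
  the unit interval are infinitely many roots of \<open>A - B\<close>.\<close>

lemma poly_poly_eqI_unit_interval:
  fixes A B :: "real poly poly"
  assumes "\<And>q t. 0 < q \<Longrightarrow> q < 1 \<Longrightarrow> 0 < t \<Longrightarrow> t < 1 \<Longrightarrow> poly (poly A [:t:]) q = poly (poly B [:t:]) q"
  shows "A = B"
proof (rule ccontr)
  assume "A \<noteq> B"
  then have "finite {x. poly (A - B) x = 0}" by (intro poly_roots_finite) simp
  moreover have "(\<lambda>t. [:t:]) ` {0<..<1} \<subseteq> {x. poly (A - B) x = 0}"
    using assms by (auto intro!: poly_eqI_unit_interval)
  ultimately have "finite ((\<lambda>t::real. [:t:]) ` {0<..<1})" by (rule finite_subset[rotated])
  then have "finite {0<..<1::real}" by (rule finite_imageD) (auto simp: inj_on_def)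
  then show False using infinite_Ioo[of 0 "1::real"] by simp
qed

lemma coeff_qv_power: "coeff (qv ^ k) i = of_bool (i = k)"
  by (simp add: monom_altdef[of 1, simplified, symmetric])

theorem theorem4p5:
  fixes n :: nat
  assumes "n \<ge> 1"
  shows "(\<forall>k. gamma_tilde n k = (\<Sum>\<sigma>\<in>Gamma_tilde n k. qv ^ maj n (inv \<sigma>))) \<and>
         q_binomial_Eulerian n =
           (\<Sum>k=0..n div 2. smult (gamma_tilde n k) (tv ^ k * (1 + tv) ^ (n - 2 * k))) \<and>
         q_gamma_positive (q_binomial_Eulerian n)"
proof -
  have gamma: "gamma_tilde n k = (\<Sum>\<sigma>\<in>Gamma_tilde n k. qv ^ maj n (inv \<sigma>))" for k
  proof (rule poly_eqI_unit_interval)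
    fix q :: real assume q: "0 < q" "q < 1"
    show "poly (gamma_tilde n k) q = poly (\<Sum>\<sigma>\<in>Gamma_tilde n k. qv ^ maj n (inv \<sigma>)) q"
      unfolding gamma_tilde_def poly_sum poly_power
      using sum_DES_inv_count_eq_imaj[OF q, where n = n and g = "\<lambda>D. of_bool (gapped D \<and> card D = k)"]
      by (simp add: sum_Gamma_tilde)
  qed
  have expansion: "q_binomial_Eulerian n =
      (\<Sum>k=0..n div 2. smult (gamma_tilde n k) (tv ^ k * (1 + tv) ^ (n - 2 * k)))"
  proof (rule poly_poly_eqI_unit_interval)
    fix q t :: real assume q: "0 < q" "q < 1" and t: "0 < t" "t < 1"
    \<comment> \<open>Only m from 1 on occurs, so the separate value of \<open>q_Eulerian\<close> at
      0 does not enter.\<close>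
    have "poly (poly (q_Eulerian m) [:t:]) q = excmaj_sum q t m" if "m \<in> {1..n}" for m
      using that by (simp add: q_Eulerian_def excmaj_sum_def poly_sum mult.commute del: One_nat_def)
    then have "poly (poly (q_binomial_Eulerian n) [:t:]) q =
        1 + t * (\<Sum>m=1..n. qpoch q n / (qpoch q m * qpoch q (n - m)) * excmaj_sum q t m)"
      by (simp add: q_binomial_Eulerian_def poly_sum poly_q_binomial[OF q] del: One_nat_def)
    also have "\<dots> = (\<Sum>\<tau> | \<tau> permutes {1..n}. gamma_weight t n (DES n \<tau>) * q ^ inv_count n \<tau>)"
      by (simp only: sum_gamma_weight_imaj[OF q t] sum_DES_inv_count_eq_imaj[OF q])
    also have "\<dots> = (\<Sum>k=0..n div 2. (\<Sum>\<sigma>\<in>Gamma_tilde n k. q ^ inv_count n \<sigma>) * (t ^ k * (1 + t) ^ (n - 2 * k)))"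
      by (rule sum_gamma_weight_eq_Gamma_tilde)
    also have "\<dots> = poly (poly (\<Sum>k=0..n div 2. smult (gamma_tilde n k) (tv ^ k * (1 + tv) ^ (n - 2 * k))) [:t:]) q"
      by (simp add: poly_sum gamma_tilde_def)
    finally show "poly (poly (q_binomial_Eulerian n) [:t:]) q =
        poly (poly (\<Sum>k=0..n div 2. smult (gamma_tilde n k) (tv ^ k * (1 + tv) ^ (n - 2 * k))) [:t:]) q" .
  qed
  have "q_positive (gamma_tilde n k)" for k
    unfolding q_positive_def gamma_tilde_def coeff_sum coeff_qv_power by (auto intro: sum_nonneg)
  with expansion have "q_gamma_positive (q_binomial_Eulerian n)"
    unfolding q_gamma_positive_def by blast
  with gamma expansion show ?thesis by blast
qed

end
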